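(* Let $d\ge 1$ and let $\mu \colon \mathbb{R}^d\setminus\{0\} \to \mathbb{R}$ be a smooth function which is positively homogeneous of degree $m \ge 2$ (i.e. $\mu(\lambda x)=\lambda^m\mu(x)$ for all $\lambda>0$, $x\neq 0$), and which satisfies \[ \det \nabla^2 \mu (x) \ne 0 \quad \text{whenever } |x|=1. \] Let $F_\mu(x)=e^{2\pi i \mu(x)}$ (a bounded function, hence a tempered distribution) and set $E_\mu = \mathcal{F}^{-1} F_\mu$. Then for every $g \in \mathcal{S}(\mathbb{R}^d)$, \[ \sup_{y \in \mathbb{R}^d} \| g(\cdot - y)\, E_\mu \|_{\mathcal{F} L^1} < \infty. \]
   Context: The Fourier transform is $\widehat{f}(\xi)=\mathcal{F} f(\xi)=\int_{\mathbb{R}^d} e^{-2\pi i \xi\cdot x} f(x)\,dx$, extended to tempered distributions $\mathcal{S}'(\mathbb{R}^d)$. $\mathcal{S}(\mathbb{R}^d)$ is the Schwartz class. For $1\le p\le\infty$, $\mathcal{F} L^p(\mathbb{R}^d)$ is the space of tempered distributions $f$ with $\widehat f\in L^p(\mathbb{R}^d)$, normed by $\|f\|_{\mathcal{F} L^p}=\|\widehat f\|_{L^p}$. *)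

theory Defs
  imports "HOL-Analysis.Analysis"
begin

definition partial_deriv :: "'n::finite \<Rightarrow> (real^'n \<Rightarrow> 'b::real_normed_vector) \<Rightarrow> real^'n \<Rightarrow> 'b" where
  "partial_deriv i f x = frechet_derivative f (at x) (axis i 1)"

fun iter_partial :: "'n::finite list \<Rightarrow> (real^'n \<Rightarrow> 'b::real_normed_vector) \<Rightarrow> real^'n \<Rightarrow> 'b" where
  "iter_partial [] f = f"
| "iter_partial (i # is) f = partial_deriv i (iter_partial is f)"

text \<open>C-infinity on an open set: every iterated partial derivative is (Frechet)
  differentiable there (hence all partial derivatives exist and are continuous).\<close>
definition smooth_on :: "(real^'n::finite) set \<Rightarrow> (real^'n \<Rightarrow> 'b::real_normed_vector) \<Rightarrow> bool" where
  "smooth_on S f \<longleftrightarrow> (\<forall>is. \<forall>x\<in>S. iter_partial is f differentiable (at x))"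

definition Schwartz :: "(real^'n::finite \<Rightarrow> complex) set" where
  "Schwartz = {f. smooth_on UNIV f \<and>
      (\<forall>is k. bounded (range (\<lambda>x. norm x ^ k * norm (iter_partial is f x))))}"

definition fourier :: "(real^'n::finite \<Rightarrow> complex) \<Rightarrow> real^'n \<Rightarrow> complex" where
  "fourier f \<xi> = (LINT x|lborel. exp (- 2 * pi * \<i> * complex_of_real (\<xi> \<bullet> x)) * f x)"

definition ifourier :: "(real^'n::finite \<Rightarrow> complex) \<Rightarrow> real^'n \<Rightarrow> complex" where
  "ifourier f x = (LINT \<xi>|lborel. exp (2 * pi * \<i> * complex_of_real (\<xi> \<bullet> x)) * f \<xi>)"

section \<open>Tempered distributions, viewed as functionals on the Schwartz class\<close>

type_synonym 'n tdist = "(real^'n \<Rightarrow> complex) \<Rightarrow> complex"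

definition reg_dist :: "(real^'n::finite \<Rightarrow> complex) \<Rightarrow> 'n tdist" where
  "reg_dist F = (\<lambda>\<phi>. LINT x|lborel. F x * \<phi> x)"

definition dist_fourier :: "'n::finite tdist \<Rightarrow> 'n tdist" where
  "dist_fourier T = (\<lambda>\<phi>. T (fourier \<phi>))"

definition dist_ifourier :: "'n::finite tdist \<Rightarrow> 'n tdist" where
  "dist_ifourier T = (\<lambda>\<phi>. T (ifourier \<phi>))"

definition dist_mult :: "(real^'n::finite \<Rightarrow> complex) \<Rightarrow> 'n tdist \<Rightarrow> 'n tdist" where
  "dist_mult g T = (\<lambda>\<phi>. T (\<lambda>x. g x * \<phi> x))"

definition FL1_reps :: "'n::finite tdist \<Rightarrow> (real^'n \<Rightarrow> complex) set" where
  "FL1_reps T = {h. integrable lborel h \<and>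
      (\<forall>\<phi>\<in>Schwartz. dist_fourier T \<phi> = (LINT x|lborel. h x * \<phi> x))}"

text \<open>\<open>\<parallel>T\<parallel>_{FL^1} = \<parallel>\<hat>T\<parallel>_{L^1}\<close>, and \<open>\<infinity>\<close> if \<open>T \<notin> FL^1\<close>.\<close>
definition FL1_norm :: "'n::finite tdist \<Rightarrow> ennreal" where
  "FL1_norm T = (INF h\<in>FL1_reps T. \<integral>\<^sup>+ x. ennreal (norm (h x)) \<partial>lborel)"

end

theory Submission
  imports Defs "HOL-Probability.Sinc_Integral"
begin

text \<open>Writing \<open>G\<close> for the inverse Fourier transform of \<open>g\<close>, the Fourier transform of the localised
  kernel is (up to a unimodular factor) the function \<open>z \<mapsto> \<integral> exp(2\<pi>i(\<mu>(z + t) + y \<bullet> t)) G(t) dt\<close>, and it must be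
  bounded in \<open>L\<^sup>1\<close> uniformly in \<open>y\<close>. After subtracting the linear part of \<open>\<mu>\<close> at \<open>z\<close>, all derivatives
  of the phase are \<open>O(|z|^(m-2))\<close> up to powers of \<open>1 + |t|\<close> that \<open>G\<close> absorbs, so integrating by parts
  against the pure exponential gives the bound \<open>(1 + |\<nabla>\<mu>(z) + y| / |z|^(m-2))^(-2d)\<close>.
  On each of finitely many narrow cones, \<open>|\<nabla>\<mu>(z) - \<nabla>\<mu>(z')| \<ge> c |z|^(m-2) |z - z'|\<close>; taking for \<open>z'\<close> a near
  minimiser of \<open>|\<nabla>\<mu> + y|\<close> on the cone bounds the kernel there by \<open>C (1 + |z - z'|)^(-2d)\<close>, whose
  integral does not depend on \<open>y\<close>.\<close>

section \<open>Polynomial weights and integration over the whole space\<close>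

text \<open>Integration by parts detects a frequency only in units of |z|^(m-2), while the
  nondegenerate Hessian stretches distances by that same factor, so the two cancel. As m \<ge> 2,
  the factor is at least 1 for |z| \<ge> 1 and can absorb bounded errors. A near minimiser is taken
  because -y need not be a value of the gradient on the cone; nothing is known about its size, so
  the gradient bound has to be weighted by |z| alone.

  The phase may be singular at the origin, which the integral over t meets at t = -z. It is replaced
  by a cut-off phase; this changes the kernel only through |x| < 2, where the translates of G decay
  in z whatever y is. Since 2d integrations by parts suffice, a cutoff of finite smoothness is
  enough, and since they run along one axis at a time, only repeated derivatives in a single
  direction are tracked.\<close>

lemma weight_le_prod:
  fixes x :: "real^'n::finite"
  shows "1 / (1 + norm x) ^ (2 * CARD('n)) \<le> (\<Prod>i\<in>UNIV. inverse (1 + (x $ i)\<^sup>2))"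
proof -
  have "1 + (x $ i)\<^sup>2 \<le> (1 + norm x)\<^sup>2" for i
  proof -
    have "(x $ i)\<^sup>2 \<le> (norm x)\<^sup>2"
      using component_le_norm_cart[of x i] by (simp add: abs_le_square_iff[symmetric])
    moreover have "(1 + norm x)\<^sup>2 = 1 + 2 * norm x + (norm x)\<^sup>2"
      by (simp add: power2_sum)
    ultimately show ?thesis using norm_ge_zero[of x] by linarith
  qed
  then have "(\<Prod>i\<in>UNIV. 1 + (x $ i)\<^sup>2) \<le> (\<Prod>i\<in>(UNIV::'n set). (1 + norm x)\<^sup>2)"
    by (intro prod_mono) (simp add: add_nonneg_nonneg)
  also have "\<dots> = (1 + norm x) ^ (2 * CARD('n))"
    by (simp add: power_mult)
  finally have *: "(\<Prod>i\<in>UNIV. 1 + (x $ i)\<^sup>2) \<le> (1 + norm x) ^ (2 * CARD('n))" .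
  have "0 < (\<Prod>i\<in>UNIV. 1 + (x $ i)\<^sup>2)"
    by (intro prod_pos) (simp add: add_pos_nonneg)
  with * show ?thesis
    by (simp add: inverse_eq_divide frac_le prod_dividef)
qed

text \<open>Tonelli on the product majorant reduces this to the integral of 1/(1+t^2) over the line;
  this comparison is the origin of the exponent 2d.\<close>

lemma integrable_weight:
  "integrable lborel (\<lambda>x::real^'n::finite. 1 / (1 + norm x) ^ (2 * CARD('n)))"
proof (rule integrableI_bounded)
  show "(\<lambda>x::real^'n. 1 / (1 + norm x) ^ (2 * CARD('n))) \<in> borel_measurable lborel"
    by measurable
  define J where "J = (\<integral>\<^sup>+ t. ennreal (inverse (1 + t\<^sup>2)) \<partial>(lborel :: real measure))"
  have "integrable lborel (\<lambda>t::real. inverse (1 + t\<^sup>2))"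
    using integrable_inverse_1_plus_square by (simp add: set_integrable_def)
  then have J: "J < \<infinity>"
    unfolding J_def integrable_iff_bounded by (simp add: add_nonneg_nonneg)
  have "(\<integral>\<^sup>+ x. ennreal (norm (1 / (1 + norm x) ^ (2 * CARD('n)))) \<partial>(lborel :: (real^'n) measure))
     \<le> (\<integral>\<^sup>+ x. (\<Prod>b\<in>Basis. ennreal (inverse (1 + (x \<bullet> b)\<^sup>2))) \<partial>(lborel :: (real^'n) measure))"
  proof (rule nn_integral_mono)
    fix x :: "real^'n"
    have "(\<Prod>b\<in>Basis. ennreal (inverse (1 + (x \<bullet> b)\<^sup>2))) = ennreal (\<Prod>b\<in>Basis. inverse (1 + (x \<bullet> b)\<^sup>2))"
      by (intro prod_ennreal) (simp add: add_nonneg_nonneg)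
    also have "(\<Prod>b\<in>Basis. inverse (1 + (x \<bullet> b)\<^sup>2)) = (\<Prod>i\<in>UNIV. inverse (1 + (x $ i)\<^sup>2))"
    proof -
      have B: "(Basis :: (real^'n) set) = (\<lambda>i. axis i 1) ` UNIV"
        by (auto simp: Basis_vec_def)
      have "inj (\<lambda>i::'n. axis i (1::real))"
        by (auto simp: inj_on_def axis_eq_axis)
      then show ?thesis
        unfolding B by (simp add: prod.reindex comp_def inner_axis)
    qed
    finally show "ennreal (norm (1 / (1 + norm x) ^ (2 * CARD('n))))
        \<le> (\<Prod>b\<in>Basis. ennreal (inverse (1 + (x \<bullet> b)\<^sup>2)))"
      using weight_le_prod[of x] by (simp add: ennreal_leI)
  qed
  also have "\<dots> = (\<Prod>b\<in>(Basis :: (real^'n) set). J)"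
    unfolding J_def by (rule nn_integral_lborel_prod) (auto simp: add_nonneg_nonneg)
  also have "\<dots> < \<infinity>"
    using J by (simp add: power_less_top_ennreal)
  finally show "(\<integral>\<^sup>+ x. ennreal (norm (1 / (1 + norm x) ^ (2 * CARD('n)))) \<partial>(lborel :: (real^'n) measure)) < \<infinity>" .
qed

lemma one_plus_norm_add_le:
  "1 + norm (x + y) \<le> (1 + norm x) * (1 + norm (y :: 'a::real_normed_vector))"
proof -
  have "0 \<le> norm x * norm y" by simp
  then show ?thesis
    using norm_triangle_ineq[of x y] unfolding distrib_left distrib_right by linarith
qed

text \<open>Peetre's inequality: a weight is recentred at the price of a polynomial factor in the
  shift.\<close>

lemma weight_shift_le:
  fixes x y :: "'a::real_normed_vector"
  shows "1 / (1 + norm (x + y)) ^ M \<le> (1 + norm y) ^ M / (1 + norm x) ^ M"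
proof -
  have pos: "0 < 1 + norm u" for u :: 'a
    using norm_ge_zero[of u] by linarith
  have "1 + norm x \<le> (1 + norm (x + y)) * (1 + norm y)"
    using one_plus_norm_add_le[of "x + y" "- y"] by simp
  then have "(1 + norm x) ^ M \<le> ((1 + norm (x + y)) * (1 + norm y)) ^ M"
    using pos[of x] by (intro power_mono) auto
  then show ?thesis
    using pos[of x] pos[of "x + y"]
    unfolding power_mult_distrib by (simp add: pos_le_divide_eq pos_divide_le_eq mult.commute)
qed

lemma integrable_weight_le:
  fixes f :: "real^'n::finite \<Rightarrow> 'b::{banach, second_countable_topology}"
  assumes "f \<in> borel_measurable borel"
    and "\<And>x. norm (f x) \<le> C / (1 + norm x) ^ (2 * CARD('n))"
  shows "integrable lborel f"
proof (rule Bochner_Integration.integrable_bound)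
  show "integrable lborel (\<lambda>x::real^'n. C * (1 / (1 + norm x) ^ (2 * CARD('n))))"
    by (intro integrable_mult_right integrable_weight)
  show "AE x in lborel. norm (f x) \<le> norm (C * (1 / (1 + norm x) ^ (2 * CARD('n))))"
    unfolding real_norm_def
    by (intro AE_I2 order_trans[OF _ abs_ge_self]) (simp add: assms(2))
qed (use assms in simp)

lemma norm_integral_weight_le:
  fixes f :: "real^'n::finite \<Rightarrow> 'b::{banach, second_countable_topology}"
  assumes "f \<in> borel_measurable borel"
    and "\<And>x. norm (f x) \<le> C / (1 + norm x) ^ (2 * CARD('n))"
  shows "norm (LINT x|lborel. f x) \<le> C * (LINT x|lborel. 1 / (1 + norm (x::real^'n)) ^ (2 * CARD('n)))"
proof -
  have "norm (LINT x|lborel. f x) \<le> (LINT x|lborel. norm (f x))"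
    by (rule integral_norm_bound)
  also have "\<dots> \<le> (LINT x|lborel. C * (1 / (1 + norm (x::real^'n)) ^ (2 * CARD('n))))"
    using integrable_weight_le[OF assms] assms(2)
    by (intro integral_mono integrable_norm integrable_mult_right integrable_weight) auto
  finally show ?thesis unfolding integral_mult_right_zero .
qed

lemma lborel_integral_shift:
  fixes f :: "'a::euclidean_space \<Rightarrow> 'b::{banach, second_countable_topology}"
  assumes [measurable]: "f \<in> borel_measurable borel"
  shows "(LINT x|lborel. f (c + x)) = (LINT x|lborel. f x)"
  by (subst (2) lborel_distr_plus[of c, symmetric]) (simp add: integral_distr)

section \<open>Functions with bounded iterated directional derivatives\<close>

definition has_dirderiv :: "'a::real_normed_vector \<Rightarrow> ('a \<Rightarrow> 'b::real_normed_vector) \<Rightarrow> 'a \<Rightarrow> 'b \<Rightarrow> bool" where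
  "has_dirderiv e f x d \<longleftrightarrow> ((\<lambda>s. f (x + s *\<^sub>R e)) has_vector_derivative d) (at 0)"

definition dirderiv :: "'a::real_normed_vector \<Rightarrow> ('a \<Rightarrow> 'b::real_normed_vector) \<Rightarrow> 'a \<Rightarrow> 'b" where
  "dirderiv e f x = vector_derivative (\<lambda>s. f (x + s *\<^sub>R e)) (at 0)"

text \<open>Orders 0 to \<open>L\<close> of the repeated derivative along one vector share the
  majorant \<open>B\<close>, which keeps products and exponentials manageable. The choice-defined
  \<open>dirderiv\<close> is asserted to be a true derivative at the orders below
  \<open>L\<close>.\<close>

fun dbound :: "'a::real_normed_vector \<Rightarrow> 'a set \<Rightarrow> nat \<Rightarrow> ('a \<Rightarrow> 'b::real_normed_vector) \<Rightarrow> ('a \<Rightarrow> real) \<Rightarrow> bool" where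
  "dbound e S 0 f B \<longleftrightarrow> (\<forall>x\<in>S. norm (f x) \<le> B x)"
| "dbound e S (Suc L) f B \<longleftrightarrow> (\<forall>x\<in>S. norm (f x) \<le> B x) \<and>
     (\<forall>x\<in>S. has_dirderiv e f x (dirderiv e f x)) \<and> dbound e S L (dirderiv e f) B"

lemma dirderiv_eqI: "has_dirderiv e f x d \<Longrightarrow> dirderiv e f x = d"
  unfolding has_dirderiv_def dirderiv_def by (rule vector_derivative_at)

lemma has_dirderiv_along:
  assumes "has_dirderiv e f (x + s *\<^sub>R e) d"
  shows "((\<lambda>s. f (x + s *\<^sub>R e)) has_vector_derivative d) (at s)"
proof -
  have "((\<lambda>u. f (x + s *\<^sub>R e + u *\<^sub>R e)) \<circ> (\<lambda>u. u - s) has_vector_derivative 1 *\<^sub>R d) (at s)"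
    by (rule vector_diff_chain_at)
      (use assms in \<open>auto simp: has_dirderiv_def has_vector_derivative_diff_const intro!: derivative_eq_intros\<close>)
  then show ?thesis
    by (simp add: comp_def algebra_simps)
qed

lemma has_dirderiv_cong:
  assumes "open S" "x \<in> S" "\<And>u. u \<in> S \<Longrightarrow> f u = g u" "has_dirderiv e f x d"
  shows "has_dirderiv e g x d"
  unfolding has_dirderiv_def
proof (rule has_vector_derivative_transform_within_open)
  show "((\<lambda>s. f (x + s *\<^sub>R e)) has_vector_derivative d) (at 0)"
    using assms(4) by (simp add: has_dirderiv_def)
  show "open ((\<lambda>s::real. x + s *\<^sub>R e) -` S)"
    by (intro open_vimage assms continuous_intros)
qed (use assms in auto)

lemma dirderiv_cong:
  assumes "open S" "x \<in> S" "\<And>u. u \<in> S \<Longrightarrow> f u = g u"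
  shows "dirderiv e f x = dirderiv e g x"
proof -
  have "has_dirderiv e f x d \<longleftrightarrow> has_dirderiv e g x d" for d
    using has_dirderiv_cong[of S x f g e d] has_dirderiv_cong[of S x g f e d] assms by metis
  then show ?thesis
    unfolding dirderiv_def has_dirderiv_def vector_derivative_def by simp
qed

lemma dbound_cong:
  assumes "open S" "\<And>u. u \<in> S \<Longrightarrow> f u = g u" "dbound e S L f B"
  shows "dbound e S L g B"
  using assms(2,3)
proof (induction L arbitrary: f g)
  case (Suc L)
  have d: "dirderiv e f x = dirderiv e g x" if "x \<in> S" for x
    using dirderiv_cong[OF assms(1) that] Suc.prems(1) by blast
  have "has_dirderiv e g x (dirderiv e g x)" if "x \<in> S" for x
    using has_dirderiv_cong[OF assms(1) that, of f g] Suc.prems that d by (metis dbound.simps(2))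
  moreover have "dbound e S L (dirderiv e g) B"
    using Suc.IH[of "dirderiv e f" "dirderiv e g"] d Suc.prems by simp
  ultimately show ?case using Suc.prems by auto
qed simp

text \<open>Peels off one order with an explicit derivative in place of the choice-defined one. The
  two agree on \<open>S\<close> only; openness of \<open>S\<close> carries the agreement to their
  own derivatives.\<close>

lemma dbound_Suc_cong:
  assumes "open S" "\<And>x. x \<in> S \<Longrightarrow> has_dirderiv e f x (f' x)"
    "\<And>x. x \<in> S \<Longrightarrow> norm (f x) \<le> B x" "dbound e S L f' B"
  shows "dbound e S (Suc L) f B"
proof -
  have "f' x = dirderiv e f x" if "x \<in> S" for x
    using dirderiv_eqI assms(2) that by metis
  then show ?thesis
    using assms dbound_cong[of S f' "dirderiv e f" e L B] by auto
qed

lemma dbound_mono: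
  assumes "dbound e S L f B" "\<And>x. x \<in> T \<Longrightarrow> B x \<le> B' x" "T \<subseteq> S"
  shows "dbound e T L f B'"
  using assms(1)
proof (induction L arbitrary: f)
  case 0
  then show ?case using assms(2,3) by (auto intro: order_trans)
next
  case (Suc L)
  then show ?case using assms(2,3) by (auto, meson order_trans subsetD)
qed

lemma dbound_Un:
  "dbound e S L f B \<Longrightarrow> dbound e T L f B \<Longrightarrow> dbound e (S \<union> T) L f B"
  by (induction L arbitrary: f) auto

lemma dbound_le: "dbound e S L f B \<Longrightarrow> K \<le> L \<Longrightarrow> dbound e S K f B"
proof (induction L arbitrary: f K)
  case (Suc L)
  then show ?case by (cases K) auto
qed simp

lemma dbound_norm: "dbound e S L f B \<Longrightarrow> x \<in> S \<Longrightarrow> norm (f x) \<le> B x"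
  by (cases L) auto

lemma dbound_const: "\<lbrakk>open S; \<And>x. x \<in> S \<Longrightarrow> norm c \<le> B x\<rbrakk> \<Longrightarrow> dbound e S L (\<lambda>x. c) B"
proof (induction L arbitrary: c)
  case (Suc L)
  show ?case
  proof (rule dbound_Suc_cong)
    show "dbound e S L (\<lambda>x. 0 :: 'b) B"
      using Suc by (intro Suc.IH) (auto intro: order_trans[OF norm_ge_zero])
  qed (use Suc in \<open>auto simp: has_dirderiv_def\<close>)
qed auto

lemma dbound_add:
  assumes "open S" "dbound e S L f A" "dbound e S L g B"
  shows "dbound e S L (\<lambda>x. f x + g x) (\<lambda>x. A x + B x)"
  using assms(2,3)
proof (induction L arbitrary: f g)
  case (Suc L)
  show ?case
  proof (rule dbound_Suc_cong[OF assms(1)])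
    show "has_dirderiv e (\<lambda>x. f x + g x) x (dirderiv e f x + dirderiv e g x)" if "x \<in> S" for x
      using Suc.prems that by (auto simp: has_dirderiv_def intro!: derivative_intros)
  qed (use Suc in \<open>auto intro: norm_triangle_mono\<close>)
qed (auto intro: norm_triangle_mono)

text \<open>By the Leibniz rule each further order turns a product into a sum of two products, so
  the constant doubles.\<close>

lemma dbound_mult:
  fixes f g :: "'a::real_normed_vector \<Rightarrow> 'b::real_normed_algebra"
  assumes "open S" "dbound e S L f A" "dbound e S L g B"
  shows "dbound e S L (\<lambda>x. f x * g x) (\<lambda>x. 2 ^ L * A x * B x)"
  using assms(2,3)
proof (induction L arbitrary: f g)
  case 0
  have "norm (f x * g x) \<le> A x * B x" if "x \<in> S" for x
  proof -
    have "norm (f x * g x) \<le> norm (f x) * norm (g x)" by (rule norm_mult_ineq)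
    also have "\<dots> \<le> A x * B x"
      using 0 that by (intro mult_mono') auto
    finally show ?thesis .
  qed
  then show ?case by auto
next
  case (Suc L)
  show ?case
  proof (rule dbound_Suc_cong[OF assms(1)])
    show "has_dirderiv e (\<lambda>x. f x * g x) x (f x * dirderiv e g x + dirderiv e f x * g x)" if "x \<in> S" for x
    proof -
      have "((\<lambda>s. f (x + s *\<^sub>R e) * g (x + s *\<^sub>R e)) has_vector_derivative
          f (x + 0 *\<^sub>R e) * dirderiv e g x + dirderiv e f x * g (x + 0 *\<^sub>R e)) (at 0)"
        using Suc.prems that
        by (intro has_vector_derivative_mult) (auto simp: has_dirderiv_def)
      then show ?thesis by (simp add: has_dirderiv_def)
    qed
    show "norm (f x * g x) \<le> 2 ^ Suc L * A x * B x" if "x \<in> S" for x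
    proof -
      have "norm (f x * g x) \<le> norm (f x) * norm (g x)" by (rule norm_mult_ineq)
      also have "\<dots> \<le> A x * B x"
        using Suc.prems that by (intro mult_mono') auto
      finally have *: "norm (f x * g x) \<le> A x * B x" .
      then have "0 \<le> A x * B x" using norm_ge_zero order_trans by blast
      then have "1 * (A x * B x) \<le> 2 ^ Suc L * (A x * B x)"
        by (intro mult_right_mono one_le_power) auto
      with * show ?thesis by (simp add: mult.assoc)
    qed
    have "dbound e S L (\<lambda>x. f x * dirderiv e g x + dirderiv e f x * g x)
        (\<lambda>x. 2 ^ L * A x * B x + 2 ^ L * A x * B x)"
      by (intro dbound_add assms Suc.IH)
        (use Suc.prems dbound_le[of e S "Suc L" _ _ L] in auto)
    then show "dbound e S L (\<lambda>x. f x * dirderiv e g x + dirderiv e f x * g x) (\<lambda>x. 2 ^ Suc L * A x * B x)"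
      by (simp add: algebra_simps)
  qed
qed

lemma dbound_of_real:
  assumes "open S" "dbound e S L f B"
  shows "dbound e S L (\<lambda>x. of_real (f x) :: 'b::{real_normed_algebra_1, real_inner}) B"
  using assms(2)
proof (induction L arbitrary: f)
  case (Suc L)
  show ?case
    by (rule dbound_Suc_cong[OF assms(1), where f' = "\<lambda>x. of_real (dirderiv e f x)"])
      (use Suc in \<open>auto simp: has_dirderiv_def has_vector_derivative_of_real has_real_derivative_iff_has_vector_derivative\<close>)
qed simp

lemma dbound_translate:
  assumes "dbound e UNIV L f B"
  shows "dbound e UNIV L (\<lambda>x. f (z + x)) (\<lambda>x. B (z + x))"
  using assms
proof (induction L arbitrary: f)
  case (Suc L)
  show ?case
    by (rule dbound_Suc_cong[where f' = "\<lambda>x. dirderiv e f (z + x)"])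
      (use Suc in \<open>auto simp: has_dirderiv_def simp flip: add.assoc\<close>)
qed simp

text \<open>The fixed exponent \<open>L0\<close> keeps the constant uniform along the induction on \<open>L\<close>.\<close>
lemma dbound_exp_mult:
  fixes \<rho> H :: "'a::real_normed_vector \<Rightarrow> complex"
  assumes "open S" and unit: "\<And>x. x \<in> S \<Longrightarrow> norm (exp (\<rho> x)) = 1"
    and diff: "\<And>x. x \<in> S \<Longrightarrow> has_dirderiv e \<rho> x (dirderiv e \<rho> x)"
    and P: "dbound e S L0 (dirderiv e \<rho>) P" "\<And>x. x \<in> S \<Longrightarrow> 1 \<le> P x"
    and "L \<le> L0" "dbound e S L H Q"
  shows "dbound e S L (\<lambda>x. exp (\<rho> x) * H x) (\<lambda>x. (2 ^ Suc L0 * P x) ^ L * Q x)"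
  using assms(6,7)
proof (induction L arbitrary: H Q)
  case 0
  then show ?case using unit by (auto simp: norm_mult)
next
  case (Suc L)
  \<comment> \<open>The derivative of exp(\<rho>) H is exp(\<rho>) H', so the unimodular factor
    persists and the induction runs on H, its majorant growing by the factor 2^(L0+1) P at each
    order.\<close>
  define H' where "H' x = dirderiv e \<rho> x * H x + dirderiv e H x" for x
  define Q' where "Q' x = 2 ^ Suc L0 * P x * Q x" for x
  have Q0: "0 \<le> Q x" if "x \<in> S" for x
    using Suc.prems(2) that by (auto intro: order_trans[OF norm_ge_zero])
  have PQ: "Q x \<le> P x * Q x" if "x \<in> S" for x
    using P(2)[OF that] Q0[OF that] by (simp add: mult_le_cancel_right1)
  have big: "1 \<le> 2 ^ Suc L0 * P x" if "x \<in> S" for x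
    using P(2)[OF that] mult_mono[of 1 "2 ^ Suc L0" 1 "P x"] one_le_power[of "2::real" "Suc L0"] by simp
  show ?case
  proof (rule dbound_Suc_cong[OF assms(1)])
    show "has_dirderiv e (\<lambda>x. exp (\<rho> x) * H x) x (exp (\<rho> x) * H' x)" if "x \<in> S" for x
    proof -
      have *: "((\<lambda>s. \<rho> (x + s *\<^sub>R e)) has_vector_derivative dirderiv e \<rho> x) (at 0)"
        using diff[OF that] by (simp add: has_dirderiv_def)
      have "((exp \<circ> (\<lambda>s. \<rho> (x + s *\<^sub>R e))) has_vector_derivative dirderiv e \<rho> x * exp (\<rho> x)) (at 0)"
        by (rule field_vector_diff_chain_at[OF *]) (auto intro!: derivative_eq_intros)
      then have "((\<lambda>s. exp (\<rho> (x + s *\<^sub>R e)) * H (x + s *\<^sub>R e)) has_vector_derivative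
          exp (\<rho> (x + 0 *\<^sub>R e)) * dirderiv e H x + (dirderiv e \<rho> x * exp (\<rho> x)) * H (x + 0 *\<^sub>R e)) (at 0)"
        using Suc.prems that
        by (intro has_vector_derivative_mult) (auto simp: has_dirderiv_def comp_def)
      then show ?thesis by (simp add: has_dirderiv_def H'_def algebra_simps)
    qed
    show "norm (exp (\<rho> x) * H x) \<le> (2 ^ Suc L0 * P x) ^ Suc L * Q x" if "x \<in> S" for x
    proof -
      have "norm (exp (\<rho> x) * H x) \<le> 1 * Q x"
        using Suc.prems that unit by (simp add: norm_mult)
      also have "\<dots> \<le> (2 ^ Suc L0 * P x) ^ Suc L * Q x"
        using Q0[OF that] one_le_power[OF big[OF that]] by (intro mult_right_mono)
      finally show ?thesis .
    qed
    have "dbound e S L H' (\<lambda>x. 2 ^ L * P x * Q x + Q x)"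
      unfolding H'_def
      by (intro dbound_add dbound_mult assms dbound_le[OF P(1)])
        (use Suc.prems dbound_le[of e S "Suc L" _ _ L] in auto)
    then have "dbound e S L H' Q'"
    proof (rule dbound_mono)
      fix x assume x: "x \<in> S"
      have "2 ^ L * (P x * Q x) \<le> 2 ^ L0 * (P x * Q x)"
        using Suc.prems PQ[OF x] Q0[OF x] by (intro mult_right_mono power_increasing) auto
      moreover have "Q x \<le> 2 ^ L0 * (P x * Q x)"
        using PQ[OF x] Q0[OF x] mult_mono[of 1 "2 ^ L0" "Q x" "P x * Q x"] one_le_power[of "2::real" L0] by simp
      ultimately show "2 ^ L * P x * Q x + Q x \<le> Q' x"
        by (simp add: Q'_def mult.assoc)
    qed simp
    then have "dbound e S L (\<lambda>x. exp (\<rho> x) * H' x) (\<lambda>x. (2 ^ Suc L0 * P x) ^ L * Q' x)"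
      using Suc.prems by (intro Suc.IH) auto
    then show "dbound e S L (\<lambda>x. exp (\<rho> x) * H' x) (\<lambda>x. (2 ^ Suc L0 * P x) ^ Suc L * Q x)"
      by (simp add: Q'_def mult_ac)
  qed
qed

section \<open>Differentiation under the integral sign and integration by parts\<close>

lemma has_vector_derivative_iff_quotient:
  "(f has_vector_derivative D) (at x within S) \<longleftrightarrow> ((\<lambda>y. (f y - f x) /\<^sub>R (y - x)) \<longlongrightarrow> D) (at x within S)"
proof -
  have "norm (f y - f x - (y - x) *\<^sub>R D) / norm (y - x) = norm ((f y - f x) /\<^sub>R (y - x) - D)" if "y \<noteq> x" for y
  proof -
    have "(f y - f x) /\<^sub>R (y - x) - D = (f y - f x - (y - x) *\<^sub>R D) /\<^sub>R (y - x)"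
      using that by (simp add: scaleR_diff_right)
    then show ?thesis
      by (simp add: divide_inverse mult.commute)
  qed
  then have "((\<lambda>y. norm (f y - f x - (y - x) *\<^sub>R D) / norm (y - x)) \<longlongrightarrow> 0) (at x within S) \<longleftrightarrow>
      ((\<lambda>y. norm ((f y - f x) /\<^sub>R (y - x) - D)) \<longlongrightarrow> 0) (at x within S)"
    by (intro Lim_cong_within) auto
  then show ?thesis
    unfolding has_vector_derivative_def has_derivative_iff_norm
    by (simp add: bounded_linear_scaleR_left tendsto_norm_zero_iff LIM_zero_iff)
qed

text \<open>The mean value inequality on [-1,1] bounds the difference quotients by \<open>w\<close>,
  and dominated convergence applies. Measurability of \<open>k' 0\<close> is a conclusion, since it
  is the limit of the quotients along 1/(i+1).\<close>

lemma has_vector_derivative_lebesgue_integral: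
  fixes k :: "real \<Rightarrow> 'a \<Rightarrow> 'b::{banach, second_countable_topology}"
  assumes meas: "\<And>s. k s \<in> borel_measurable M"
    and int: "integrable M (k 0)" "integrable M w"
    and der: "\<And>s \<xi>. \<bar>s\<bar> \<le> 1 \<Longrightarrow> ((\<lambda>s. k s \<xi>) has_vector_derivative k' s \<xi>) (at s)"
    and bound: "\<And>s \<xi>. \<bar>s\<bar> \<le> 1 \<Longrightarrow> norm (k' s \<xi>) \<le> w \<xi>"
  shows "k' 0 \<in> borel_measurable M"
    and "((\<lambda>s. integral\<^sup>L M (k s)) has_vector_derivative integral\<^sup>L M (k' 0)) (at 0)"
proof -
  define q where "q s \<xi> = (k s \<xi> - k 0 \<xi>) /\<^sub>R s" for s \<xi>
  have q_meas: "q s \<in> borel_measurable M" for s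
    unfolding q_def using meas by measurable
  have diff: "norm (k s \<xi> - k 0 \<xi>) \<le> w \<xi> * \<bar>s\<bar>" if "\<bar>s\<bar> \<le> 1" for s \<xi>
  proof -
    have "norm (k s \<xi> - k 0 \<xi>) \<le> w \<xi> * norm (s - 0)"
    proof (rule differentiable_bound[of "{-1..1}"])
      fix u :: real assume "u \<in> {-1..1}"
      then have u: "\<bar>u\<bar> \<le> 1" by auto
      show "((\<lambda>s. k s \<xi>) has_derivative (\<lambda>h. h *\<^sub>R k' u \<xi>)) (at u within {-1..1})"
        using der[OF u] by (auto simp: has_vector_derivative_def intro: has_derivative_at_withinI)
      show "onorm (\<lambda>h. h *\<^sub>R k' u \<xi>) \<le> w \<xi>"
        using bound[OF u] by (intro onorm_le) (simp add: mult.commute[of "w _"] mult_left_mono)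
    qed (use that in auto)
    then show ?thesis by simp
  qed
  have q_bound: "norm (q s \<xi>) \<le> w \<xi>" if "\<bar>s\<bar> \<le> 1" "s \<noteq> 0" for s \<xi>
    using diff[OF that(1), of \<xi>] that(2)
    by (simp add: q_def divide_inverse_commute[symmetric] pos_divide_le_eq)
  have q_lim: "(\<lambda>i. q (X i) \<xi>) \<longlonglongrightarrow> k' 0 \<xi>" if "\<And>i. X i \<noteq> 0" "X \<longlonglongrightarrow> 0" for X \<xi>
  proof -
    have "((\<lambda>s. q s \<xi>) \<longlongrightarrow> k' 0 \<xi>) (at 0)"
      using der[of 0 \<xi>] unfolding has_vector_derivative_iff_quotient q_def by simp
    then show ?thesis
      using that unfolding tendsto_at_iff_sequentially comp_def by auto
  qed
  show k'_meas: "k' 0 \<in> borel_measurable M"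
  proof (rule borel_measurable_LIMSEQ_metric)
    show "(\<lambda>i. q (inverse (real (Suc i))) \<xi>) \<longlonglongrightarrow> k' 0 \<xi>" for \<xi>
      by (rule q_lim[OF _ LIMSEQ_inverse_real_of_nat]) simp
  qed (rule q_meas)
  have k_int: "integrable M (k s)" if "\<bar>s\<bar> \<le> 1" for s
  proof -
    have w0: "0 \<le> w \<xi>" for \<xi>
      using order_trans[OF norm_ge_zero bound[of 0 \<xi>]] by simp
    have "norm (k s \<xi>) \<le> norm (k 0 \<xi>) + w \<xi>" for \<xi>
    proof -
      have "norm (k s \<xi>) \<le> norm (k 0 \<xi>) + norm (k s \<xi> - k 0 \<xi>)"
        by (metis norm_triangle_sub)
      moreover have "w \<xi> * \<bar>s\<bar> \<le> w \<xi>"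
        using that w0[of \<xi>] by (simp add: mult_left_le)
      ultimately show ?thesis using diff[OF that, of \<xi>] by linarith
    qed
    then have "AE \<xi> in M. norm (k s \<xi>) \<le> norm (norm (k 0 \<xi>) + w \<xi>)"
      unfolding real_norm_def by (intro AE_I2 order_trans[OF _ abs_ge_self])
    moreover have "integrable M (\<lambda>\<xi>. norm (k 0 \<xi>) + w \<xi>)"
      by (intro Bochner_Integration.integrable_add integrable_norm int)
    ultimately show ?thesis
      using Bochner_Integration.integrable_bound meas by blast
  qed
  have "((\<lambda>s. (integral\<^sup>L M (k s) - integral\<^sup>L M (k 0)) /\<^sub>R (s - 0)) \<longlongrightarrow> integral\<^sup>L M (k' 0))
      (at 0 within {-1..1})"
    unfolding tendsto_at_iff_sequentially comp_def
  proof (intro allI impI)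
    fix X :: "nat \<Rightarrow> real" assume X: "\<forall>i. X i \<in> {- 1..1} - {0}" "X \<longlonglongrightarrow> 0"
    then have X1: "\<bar>X i\<bar> \<le> 1" "X i \<noteq> 0" for i
      by (auto simp: abs_le_iff minus_le_iff)
    have "(\<lambda>i. integral\<^sup>L M (q (X i))) \<longlonglongrightarrow> integral\<^sup>L M (k' 0)"
      by (rule integral_dominated_convergence[OF k'_meas q_meas int(2)])
        (use q_bound q_lim X X1 in auto)
    moreover have "integral\<^sup>L M (q (X i)) = (integral\<^sup>L M (k (X i)) - integral\<^sup>L M (k 0)) /\<^sub>R (X i - 0)" for i
      unfolding q_def using k_int[OF X1(1)] int(1) by simp
    ultimately show "(\<lambda>i. (integral\<^sup>L M (k (X i)) - integral\<^sup>L M (k 0)) /\<^sub>R (X i - 0))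
        \<longlonglongrightarrow> integral\<^sup>L M (k' 0)"
      by simp
  qed
  moreover have "at 0 within {-1..1::real} = at 0"
    by (rule at_within_interior) simp
  ultimately show "((\<lambda>s. integral\<^sup>L M (k s)) has_vector_derivative integral\<^sup>L M (k' 0)) (at 0)"
    unfolding has_vector_derivative_iff_quotient by simp
qed

lemma borel_measurable_dirderiv:
  fixes u :: "'a::euclidean_space \<Rightarrow> 'b::{banach, second_countable_topology}"
  assumes [measurable]: "u \<in> borel_measurable borel" and der: "\<And>x. has_dirderiv e u x (u' x)"
  shows "u' \<in> borel_measurable borel"
proof (rule borel_measurable_LIMSEQ_metric)
  show "(\<lambda>i. (u (x + inverse (real (Suc i)) *\<^sub>R e) - u x) /\<^sub>R inverse (real (Suc i))) \<longlonglongrightarrow> u' x" for x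
  proof -
    have "((\<lambda>s. (u (x + s *\<^sub>R e) - u x) /\<^sub>R s) \<longlongrightarrow> u' x) (at 0)"
      using der[of x] unfolding has_dirderiv_def has_vector_derivative_iff_quotient by simp
    then have "(\<lambda>i. (u (x + X i *\<^sub>R e) - u x) /\<^sub>R X i) \<longlonglongrightarrow> u' x" if "\<And>i. X i \<noteq> 0" "X \<longlonglongrightarrow> 0" for X
      using that unfolding tendsto_at_iff_sequentially comp_def by auto
    from this[OF _ LIMSEQ_inverse_real_of_nat] show ?thesis by simp
  qed
qed measurable

text \<open>By translation invariance the integral of u(x + s e) does not depend on s;
  differentiating under the integral at s = 0 gives the claim without boundary terms.\<close>

lemma integral_dirderiv_eq_0:
  fixes u :: "real^'n::finite \<Rightarrow> 'b::{banach, second_countable_topology}"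
  assumes [measurable]: "u \<in> borel_measurable borel"
    and der: "\<And>x. has_dirderiv e u x (u' x)" and e: "norm e \<le> 1"
    and u: "\<And>x. norm (u x) \<le> C / (1 + norm x) ^ (2 * CARD('n))"
    and u': "\<And>x. norm (u' x) \<le> C / (1 + norm x) ^ (2 * CARD('n))"
  shows "(LINT x|lborel. u' x) = 0"
proof -
  define d where "d = 2 * CARD('n)"
  have C: "0 \<le> C" using u[of 0] norm_ge_zero[of "u 0"] by (simp del: norm_ge_zero)
  have "((\<lambda>s. LINT x|lborel. u (x + s *\<^sub>R e)) has_vector_derivative (LINT x|lborel. u' (x + 0 *\<^sub>R e))) (at 0)"
  \<comment> \<open>The factor 2^d in \<open>w\<close> pays for shifting the weight by s e, where |s
    e| \<le> 1.\<close>
  proof (rule has_vector_derivative_lebesgue_integral(2)[where k = "\<lambda>s x. u (x + s *\<^sub>R e)"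
        and k' = "\<lambda>s x. u' (x + s *\<^sub>R e)" and w = "\<lambda>x. (C * 2 ^ d) * (1 / (1 + norm x) ^ d)"])
    show "integrable lborel (\<lambda>x::real^'n. (C * 2 ^ d) * (1 / (1 + norm x) ^ d))"
      unfolding d_def by (intro integrable_mult_right integrable_weight)
    show "integrable lborel (\<lambda>x. u (x + 0 *\<^sub>R e))"
      using integrable_weight_le[OF assms(1) u] by simp
    show "((\<lambda>s. u (x + s *\<^sub>R e)) has_vector_derivative u' (x + s *\<^sub>R e)) (at s)" for s x
      by (rule has_dirderiv_along[OF der])
    fix s :: real and x assume s: "\<bar>s\<bar> \<le> 1"
    have "norm (u' (x + s *\<^sub>R e)) \<le> C * (1 / (1 + norm (x + s *\<^sub>R e)) ^ d)"
      using u' by (simp add: d_def)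
    also have "\<dots> \<le> C * ((1 + norm (s *\<^sub>R e)) ^ d / (1 + norm x) ^ d)"
      by (intro mult_left_mono weight_shift_le C)
    also have "\<dots> \<le> C * (2 ^ d / (1 + norm x) ^ d)"
    proof -
      have "norm (s *\<^sub>R e) \<le> 1" using s e by (simp add: mult_le_one)
      then show ?thesis by (intro mult_left_mono divide_right_mono power_mono C) auto
    qed
    finally show "norm (u' (x + s *\<^sub>R e)) \<le> (C * 2 ^ d) * (1 / (1 + norm x) ^ d)" by simp
  qed measurable
  moreover have "(LINT x|lborel. u (x + s *\<^sub>R e)) = (LINT x|lborel. u x)" for s
    using lborel_integral_shift[OF assms(1), of "s *\<^sub>R e"] by (simp add: add.commute)
  ultimately have "((\<lambda>s. LINT x|lborel. u x) has_vector_derivative (LINT x|lborel. u' x)) (at 0)"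
    by simp
  then show ?thesis
    using vector_derivative_at[OF has_vector_derivative_const] vector_derivative_at by metis
qed

section \<open>Decay of Fourier integrals\<close>

lemma has_dirderiv_mult:
  fixes f g :: "'a::real_normed_vector \<Rightarrow> 'b::real_normed_algebra"
  assumes "has_dirderiv e f x a" "has_dirderiv e g x b"
  shows "has_dirderiv e (\<lambda>x. f x * g x) x (f x * b + a * g x)"
  using has_vector_derivative_mult[OF assms[unfolded has_dirderiv_def]]
  by (simp add: has_dirderiv_def)

lemma has_dirderiv_character:
  "has_dirderiv e (\<lambda>x. exp (2 * pi * \<i> * complex_of_real (x \<bullet> A))) x
     (2 * pi * \<i> * complex_of_real (e \<bullet> A) * exp (2 * pi * \<i> * complex_of_real (x \<bullet> A)))"
proof -
  have "((exp \<circ> (\<lambda>s. 2 * pi * \<i> * complex_of_real ((x + s *\<^sub>R e) \<bullet> A))) has_vector_derivative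
      (2 * pi * \<i> * complex_of_real (e \<bullet> A)) * exp (2 * pi * \<i> * complex_of_real (x \<bullet> A))) (at 0)"
  proof (rule field_vector_diff_chain_at)
    show "((\<lambda>s. 2 * pi * \<i> * complex_of_real ((x + s *\<^sub>R e) \<bullet> A)) has_vector_derivative
        2 * pi * \<i> * complex_of_real (e \<bullet> A)) (at 0)"
      unfolding inner_add_left inner_scaleR_left
      by (rule derivative_eq_intros refl)+ simp_all
  qed (auto intro!: derivative_eq_intros)
  then show ?thesis
    by (simp add: has_dirderiv_def comp_def)
qed

lemma norm_character [simp]: "norm (exp (2 * pi * \<i> * complex_of_real r)) = 1"
  by (simp add: norm_exp_eq_Re)

text \<open>Integration by parts: the derivative along \<open>e\<close> of the character times f has
  integral 0.\<close>

lemma ifourier_dirderiv: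
  fixes f :: "real^'n::finite \<Rightarrow> complex"
  assumes [measurable]: "f \<in> borel_measurable borel"
    and der: "\<And>x. has_dirderiv e f x (f' x)" and e: "norm e \<le> 1"
    and f: "\<And>x. norm (f x) \<le> C / (1 + norm x) ^ (2 * CARD('n))"
    and f': "\<And>x. norm (f' x) \<le> C / (1 + norm x) ^ (2 * CARD('n))"
  shows "ifourier f' A = - (2 * pi * \<i> * complex_of_real (e \<bullet> A)) * ifourier f A"
proof -
  define ch where "ch x = exp (2 * pi * \<i> * complex_of_real (x \<bullet> A))" for x :: "real^'n"
  define c where "c = 2 * pi * \<i> * complex_of_real (e \<bullet> A)"
  have [measurable]: "ch \<in> borel_measurable borel"
    unfolding ch_def by measurable
  have f'_meas[measurable]: "f' \<in> borel_measurable borel"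
    by (rule borel_measurable_dirderiv[OF assms(1) der])
  have nch: "norm (ch x) = 1" for x unfolding ch_def by simp
  have "(LINT x|lborel. ch x * f' x + (c * ch x) * f x) = 0"
  proof (rule integral_dirderiv_eq_0[where u = "\<lambda>x. ch x * f x" and C = "C + norm c * C", OF _ _ e])
    show "has_dirderiv e (\<lambda>x. ch x * f x) x (ch x * f' x + (c * ch x) * f x)" for x
      using has_dirderiv_mult[OF has_dirderiv_character der] by (simp add: ch_def c_def)
    fix x :: "real^'n"
    have "0 \<le> norm c * (C / (1 + norm x) ^ (2 * CARD('n)))"
      using order_trans[OF norm_ge_zero f[of x]] by (rule mult_nonneg_nonneg[OF norm_ge_zero])
    then show "norm (ch x * f x) \<le> (C + norm c * C) / (1 + norm x) ^ (2 * CARD('n))"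
      using f[of x] nch by (simp add: norm_mult add_divide_distrib)
    have "norm (ch x * f' x + (c * ch x) * f x) \<le> norm (f' x) + norm c * norm (f x)"
      using norm_triangle_ineq[of "ch x * f' x" "(c * ch x) * f x"] nch by (simp add: norm_mult)
    also have "\<dots> \<le> C / (1 + norm x) ^ (2 * CARD('n)) + norm c * (C / (1 + norm x) ^ (2 * CARD('n)))"
      by (intro add_mono mult_left_mono f f') auto
    finally show "norm (ch x * f' x + (c * ch x) * f x) \<le> (C + norm c * C) / (1 + norm x) ^ (2 * CARD('n))"
      by (simp add: add_divide_distrib)
  qed measurable
  moreover have "integrable lborel (\<lambda>x. ch x * f' x)" "integrable lborel (\<lambda>x. ch x * f x)"
    by (rule integrable_weight_le[where C = C]; simp add: norm_mult nch f f')+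
  ultimately have "(LINT x|lborel. ch x * f' x) + c * (LINT x|lborel. ch x * f x) = 0"
    by (simp add: mult.assoc)
  then show ?thesis
    unfolding ifourier_def ch_def c_def by (simp add: eq_neg_iff_add_eq_0)
qed

lemma ifourier_bound:
  fixes f :: "real^'n::finite \<Rightarrow> complex"
  assumes [measurable]: "f \<in> borel_measurable borel"
    and f: "\<And>x. norm (f x) \<le> C / (1 + norm x) ^ (2 * CARD('n))"
  shows "norm (ifourier f A) \<le> C * (LINT x|lborel. 1 / (1 + norm (x::real^'n)) ^ (2 * CARD('n)))"
  unfolding ifourier_def
  by (rule norm_integral_weight_le) (use f in \<open>auto simp: norm_mult\<close>)

lemma ifourier_dbound:
  fixes f :: "real^'n::finite \<Rightarrow> complex"
  assumes "f \<in> borel_measurable borel" "norm e \<le> 1"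
    and "dbound e UNIV L f (\<lambda>x. C / (1 + norm x) ^ (2 * CARD('n)))"
  shows "(2 * pi * \<bar>e \<bullet> A\<bar>) ^ L * norm (ifourier f A)
     \<le> C * (LINT x|lborel. 1 / (1 + norm (x::real^'n)) ^ (2 * CARD('n)))"
  using assms(1,3)
proof (induction L arbitrary: f)
  case 0
  then show ?case using ifourier_bound[of f C A] by simp
next
  case (Suc L)
  have f': "norm (dirderiv e f x) \<le> C / (1 + norm x) ^ (2 * CARD('n))" for x
    using Suc.prems dbound_norm[of e UNIV L "dirderiv e f"] by auto
  have "norm (ifourier (dirderiv e f) A) = 2 * pi * \<bar>e \<bullet> A\<bar> * norm (ifourier f A)"
    by (subst ifourier_dirderiv[OF Suc.prems(1) _ assms(2) _ f'])
      (use Suc.prems in \<open>auto simp: norm_mult\<close>)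
  moreover have "(2 * pi * \<bar>e \<bullet> A\<bar>) ^ L * norm (ifourier (dirderiv e f) A)
     \<le> C * (LINT x|lborel. 1 / (1 + norm (x::real^'n)) ^ (2 * CARD('n)))"
    using Suc.prems by (intro Suc.IH borel_measurable_dirderiv[OF Suc.prems(1)]) auto
  ultimately show ?case by (simp add: mult_ac)
qed

text \<open>If b is the largest |v_j|, then |v| \<le> d b and 1 + |v| \<le> (1 + d) max(1, b). For b
  \<le> 1 the plain bound on \<open>a\<close> suffices, otherwise the bound for the maximising
  component.\<close>

lemma decay_from_components:
  fixes v :: "real^'n::finite"
  assumes "0 \<le> a" "a \<le> C" "\<And>j. \<bar>v $ j\<bar> ^ M * a \<le> C"
  shows "(1 + norm v) ^ M * a \<le> (1 + real CARD('n)) ^ M * C"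
proof -
  define b where "b = Max (range (\<lambda>j. \<bar>v $ j\<bar>))"
  have "b \<in> range (\<lambda>j. \<bar>v $ j\<bar>)"
    unfolding b_def by (rule Max_in) auto
  then obtain j where j: "b = \<bar>v $ j\<bar>" by auto
  have "\<bar>v $ i\<bar> \<le> b" for i
    unfolding b_def by (rule Max_ge) auto
  then have "(\<Sum>i\<in>UNIV. \<bar>v $ i\<bar>) \<le> (\<Sum>i\<in>(UNIV::'n set). b)"
    by (intro sum_mono)
  then have nv: "norm v \<le> real CARD('n) * b"
    using norm_le_l1_cart[of v] by simp
  define m where "m = max 1 b"
  have "1 + norm v \<le> (1 + real CARD('n)) * m"
  proof -
    have "real CARD('n) * b \<le> real CARD('n) * m"
      unfolding m_def by (intro mult_left_mono) auto
    moreover have "1 \<le> m" by (simp add: m_def)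
    ultimately show ?thesis using nv unfolding distrib_right by linarith
  qed
  then have "(1 + norm v) ^ M * a \<le> ((1 + real CARD('n)) * m) ^ M * a"
    using assms(1) by (intro mult_right_mono power_mono) auto
  also have "\<dots> = (1 + real CARD('n)) ^ M * (m ^ M * a)"
    by (simp add: power_mult_distrib)
  also have "m ^ M * a \<le> C"
    using assms(2) assms(3)[of j] by (cases "b \<le> 1") (auto simp: m_def j max_def)
  finally show ?thesis by (simp add: mult_left_mono)
qed

text \<open>The Schwartz conditions relaxed to pure axis derivatives. The class is still stable
  under multiplication by coordinates and under \<open>ifourier\<close>, and provides what the
  integrations by parts consume.\<close>

definition rapid :: "(real^'n::finite \<Rightarrow> complex) \<Rightarrow> bool" where
  "rapid f \<longleftrightarrow> f \<in> borel_measurable borel \<and>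
     (\<forall>j L M. \<exists>C. dbound (axis j 1) UNIV L f (\<lambda>x. C / (1 + norm x) ^ M))"

lemma rapid_measurable: "rapid f \<Longrightarrow> f \<in> borel_measurable borel"
  by (simp add: rapid_def)

lemma rapid_bound:
  assumes "rapid f"
  obtains C where "\<And>x. norm (f x) \<le> C / (1 + norm x) ^ M"
  using assms unfolding rapid_def by (metis UNIV_I dbound_norm)

lemma rapid_integrable: "rapid f \<Longrightarrow> integrable lborel f"
  by (meson rapid_bound rapid_measurable integrable_weight_le)

lemma has_dirderiv_of_differentiable:
  assumes "f differentiable (at x)"
  shows "has_dirderiv e f x (frechet_derivative f (at x) e)"
proof -
  have *: "(f has_derivative frechet_derivative f (at x)) (at x)"
    using assms frechet_derivative_works by blast
  have "((\<lambda>s. f (x + s *\<^sub>R e)) has_derivative (\<lambda>s. frechet_derivative f (at x) (s *\<^sub>R e))) (at 0)"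
    by (rule has_derivative_compose[of "\<lambda>s. x + s *\<^sub>R e" _ 0 UNIV f, simplified])
      (use * in \<open>auto intro!: derivative_eq_intros\<close>)
  then show ?thesis
    using linear_frechet_derivative[OF assms]
    by (simp add: has_dirderiv_def has_vector_derivative_def linear_cmul)
qed

lemma has_dirderiv_iter_partial:
  assumes "smooth_on S f" "x \<in> S"
  shows "has_dirderiv (axis i 1) (iter_partial is f) x (iter_partial (i # is) f x)"
  using has_dirderiv_of_differentiable[of "iter_partial is f" x "axis i 1"] assms
  by (simp add: smooth_on_def partial_deriv_def)

lemma one_plus_power_le: "0 \<le> (a::real) \<Longrightarrow> (1 + a) ^ M \<le> 2 ^ M * (1 + a ^ M)"
proof (cases "a \<le> 1")
  case True
  assume "0 \<le> a"
  then have "(1 + a) ^ M \<le> 2 ^ M" using True by (intro power_mono) auto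
  moreover have "(2::real) ^ M * 1 \<le> 2 ^ M * (1 + a ^ M)"
    using \<open>0 \<le> a\<close> by (intro mult_left_mono) auto
  ultimately show ?thesis by linarith
next
  case False
  then have "(1 + a) ^ M \<le> (2 * a) ^ M" by (intro power_mono) auto
  then show ?thesis by (simp add: power_mult_distrib distrib_left add_increasing)
qed

lemma Schwartz_imp_rapid:
  assumes g: "g \<in> Schwartz"
  shows "rapid g"
proof -
  have sm: "smooth_on UNIV g" using g by (simp add: Schwartz_def)
  have 1: "\<exists>C. \<forall>x. norm (iter_partial is g x) \<le> C / (1 + norm x) ^ M" for "is" M
  proof -
    have b: "\<exists>B. \<forall>x. norm x ^ k * norm (iter_partial is g x) \<le> B" for k
      using g unfolding Schwartz_def bounded_iff by fastforce
    \<comment> \<open>The bounds with exponents 0 and M combine through (1 + a)^M \<le> 2^M (1 +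
      a^M).\<close>
    obtain B0 where B0: "\<And>x. norm x ^ 0 * norm (iter_partial is g x) \<le> B0" using b by blast
    obtain B where B: "\<And>x. norm x ^ M * norm (iter_partial is g x) \<le> B" using b by blast
    have "norm (iter_partial is g x) \<le> (2 ^ M * (B0 + B)) / (1 + norm x) ^ M" for x
    proof -
      have "(1 + norm x) ^ M * norm (iter_partial is g x) \<le> 2 ^ M * (1 + norm x ^ M) * norm (iter_partial is g x)"
        by (intro mult_right_mono one_plus_power_le) auto
      also have "\<dots> \<le> 2 ^ M * (B0 + B)"
        using B0[of x] B[of x] by (simp add: mult.assoc distrib_right)
      finally show ?thesis
        by (simp add: pos_le_divide_eq mult.commute add_pos_nonneg)
    qed
    then show ?thesis by blast
  qed
  have 2: "\<exists>C. dbound (axis j 1) UNIV L (iter_partial is g) (\<lambda>x. C / (1 + norm x) ^ M)" for j L "is" M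
  proof (induction L arbitrary: "is")
    case 0
    then show ?case using 1 by simp
  next
    case (Suc L)
    obtain C1 where C1: "\<And>x. norm (iter_partial is g x) \<le> C1 / (1 + norm x) ^ M" using 1 by blast
    obtain C2 where C2: "dbound (axis j 1) UNIV L (iter_partial (j # is) g) (\<lambda>x. C2 / (1 + norm x) ^ M)"
      using Suc by blast
    have le: "C1 / (1 + norm x) ^ M \<le> max C1 C2 / (1 + norm x) ^ M" "C2 / (1 + norm x) ^ M \<le> max C1 C2 / (1 + norm x) ^ M"
      for x :: "real^'a" by (auto intro!: divide_right_mono)
    have "dbound (axis j 1) UNIV (Suc L) (iter_partial is g) (\<lambda>x. max C1 C2 / (1 + norm x) ^ M)"
      by (rule dbound_Suc_cong[where f' = "iter_partial (j # is) g"])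
        (use has_dirderiv_iter_partial[OF sm] dbound_mono[OF C2 le(2)] order_trans[OF C1 le(1)] in auto)
    then show ?case by blast
  qed
  have "continuous_on UNIV g"
    using sm unfolding smooth_on_def
    by (metis continuous_at_imp_continuous_on differentiable_imp_continuous_within iter_partial.simps(1))
  then have "g \<in> borel_measurable borel" by (rule borel_measurable_continuous_onI)
  then show ?thesis
    unfolding rapid_def using 2[of _ _ "[]"] by simp
qed

lemma rapid_cmult:
  assumes "rapid f"
  shows "rapid (\<lambda>x. c * f x)"
  unfolding rapid_def
proof (intro conjI allI)
  show "(\<lambda>x. c * f x) \<in> borel_measurable borel"
    using rapid_measurable[OF assms] by measurable
  fix j L M
  obtain C where C: "dbound (axis j 1) UNIV L f (\<lambda>x. C / (1 + norm x) ^ M)"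
    using assms unfolding rapid_def by blast
  have "dbound (axis j 1) UNIV L (\<lambda>x. c * f x) (\<lambda>x. 2 ^ L * norm c * (C / (1 + norm x) ^ M))"
    by (intro dbound_mult C dbound_const) auto
  then have "dbound (axis j 1) UNIV L (\<lambda>x. c * f x) (\<lambda>x. (2 ^ L * norm c * C) / (1 + norm x) ^ M)"
    by simp
  then show "\<exists>C. dbound (axis j 1) UNIV L (\<lambda>x. c * f x) (\<lambda>x. C / (1 + norm x) ^ M)" by blast
qed

lemma rapid_mult_coord:
  fixes e :: "real^'n::finite"
  assumes "rapid f"
  shows "rapid (\<lambda>x. complex_of_real (x \<bullet> e) * f x)"
  unfolding rapid_def
proof (intro conjI allI)
  show "(\<lambda>x. complex_of_real (x \<bullet> e) * f x) \<in> borel_measurable borel"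
    using rapid_measurable[OF assms] by measurable
  fix j L M
  \<comment> \<open>One extra power of decay pays for the linear growth of the coordinate.\<close>
  obtain C where C: "dbound (axis j 1) UNIV L f (\<lambda>x. C / (1 + norm x) ^ Suc M)"
    using assms unfolding rapid_def by blast
  have le: "\<bar>x \<bullet> e\<bar> \<le> norm e * (1 + norm x)" for x
    using Cauchy_Schwarz_ineq2[of x e] norm_ge_zero[of e]
    unfolding distrib_left mult.commute[of "norm x"] by linarith
  have "dbound (axis j 1) UNIV L (\<lambda>x. x \<bullet> e) (\<lambda>x. norm e * (1 + norm x))"
  proof (cases L)
    case (Suc K)
    show ?thesis unfolding Suc
    proof (rule dbound_Suc_cong)
      show "has_dirderiv (axis j 1) (\<lambda>x. x \<bullet> e) x (axis j 1 \<bullet> e)" for x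
        unfolding has_dirderiv_def inner_add_left inner_scaleR_left
        by (rule derivative_eq_intros refl)+ simp_all
      have "\<bar>axis j 1 \<bullet> e\<bar> \<le> norm e"
        using Cauchy_Schwarz_ineq2[of "axis j 1" e] by simp
      then show "dbound (axis j 1) UNIV K (\<lambda>x. axis j 1 \<bullet> e) (\<lambda>x. norm e * (1 + norm x))"
        by (intro dbound_const) (auto simp: distrib_left intro: add_increasing2)
    qed (use le in auto)
  qed (use le in auto)
  from dbound_mult[OF open_UNIV dbound_of_real[OF open_UNIV this] C]
  have "dbound (axis j 1) UNIV L (\<lambda>x. complex_of_real (x \<bullet> e) * f x)
      (\<lambda>x. 2 ^ L * (norm e * (1 + norm x)) * (C / (1 + norm x) ^ Suc M))" .
  moreover have "2 ^ L * (norm e * (1 + norm x)) * (C / (1 + norm x) ^ Suc M) = (2 ^ L * norm e * C) / (1 + norm x) ^ M"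
    for x :: "real^'n"
    using add_pos_nonneg[OF zero_less_one norm_ge_zero[of x]] by simp
  ultimately have "dbound (axis j 1) UNIV L (\<lambda>x. complex_of_real (x \<bullet> e) * f x) (\<lambda>x. (2 ^ L * norm e * C) / (1 + norm x) ^ M)"
    by simp
  then show "\<exists>C. dbound (axis j 1) UNIV L (\<lambda>x. complex_of_real (x \<bullet> e) * f x) (\<lambda>x. C / (1 + norm x) ^ M)" by blast
qed

lemma measurable_ifourier:
  assumes [measurable]: "f \<in> borel_measurable borel"
  shows "ifourier f \<in> borel_measurable borel"
  unfolding ifourier_def by measurable

lemma rapid_ifourier_decay:
  fixes f :: "real^'n::finite \<Rightarrow> complex"
  assumes "rapid f"
  shows "\<exists>C. \<forall>t. norm (ifourier f t) \<le> C / (1 + norm t) ^ M"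
proof -
  define W where "W = (LINT x|lborel. 1 / (1 + norm (x::real^'n)) ^ (2 * CARD('n)))"
  have W0: "0 \<le> W" unfolding W_def by (intro integral_nonneg_AE) auto
  have "\<exists>C. \<forall>j::'n. dbound (axis j 1) UNIV M f (\<lambda>x. C j / (1 + norm x) ^ (2 * CARD('n)))"
    using assms unfolding rapid_def by (intro choice) auto
  then obtain C where C: "\<And>j::'n. dbound (axis j 1) UNIV M f (\<lambda>x. C j / (1 + norm x) ^ (2 * CARD('n)))"
    by blast
  define K where "K = (\<Sum>j\<in>UNIV. \<bar>C j\<bar>) * W"
  have CK: "C j * W \<le> K" for j
  proof -
    have "C j \<le> \<bar>C j\<bar>" by simp
    also have "\<dots> \<le> (\<Sum>j\<in>UNIV. \<bar>C j\<bar>)" by (rule member_le_sum) auto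
    finally show ?thesis unfolding K_def by (rule mult_right_mono[OF _ W0])
  qed
  have "norm (ifourier f t) \<le> ((1 + real CARD('n)) ^ M * K) / (1 + norm t) ^ M" for t
  proof -
    have "(1 + norm t) ^ M * norm (ifourier f t) \<le> (1 + real CARD('n)) ^ M * K"
    proof (rule decay_from_components)
      show "norm (ifourier f t) \<le> K"
        by (rule order_trans[OF ifourier_bound[OF rapid_measurable[OF assms] dbound_norm[OF C UNIV_I],
                folded W_def] CK])
      show "\<bar>t $ j\<bar> ^ M * norm (ifourier f t) \<le> K" for j
      proof -
        have "\<bar>t $ j\<bar> ^ M \<le> (2 * pi * \<bar>axis j 1 \<bullet> t\<bar>) ^ M"
          using pi_ge_two by (intro power_mono) (auto simp: inner_axis' mult_le_cancel_right1)
        then have "\<bar>t $ j\<bar> ^ M * norm (ifourier f t) \<le> (2 * pi * \<bar>axis j 1 \<bullet> t\<bar>) ^ M * norm (ifourier f t)"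
          by (rule mult_right_mono) simp
        also have "\<dots> \<le> C j * W"
          unfolding W_def by (rule ifourier_dbound[OF rapid_measurable[OF assms] _ C]) simp
        finally show ?thesis using CK[of j] by simp
      qed
    qed simp
    then show ?thesis
      by (simp add: pos_le_divide_eq mult.commute add_pos_nonneg)
  qed
  then show ?thesis by blast
qed

lemma has_dirderiv_ifourier:
  fixes f :: "real^'n::finite \<Rightarrow> complex"
  assumes "rapid f"
  shows "has_dirderiv e (ifourier f) t (ifourier (\<lambda>x. 2 * pi * \<i> * (complex_of_real (x \<bullet> e) * f x)) t)"
proof -
  have [measurable]: "f \<in> borel_measurable borel" by (rule rapid_measurable[OF assms])
  have int: "integrable lborel (\<lambda>x. 2 * pi * \<i> * (complex_of_real (x \<bullet> e) * f x))"
    by (intro rapid_integrable rapid_cmult rapid_mult_coord assms)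
  have "((\<lambda>s. LINT x|lborel. exp (2 * pi * \<i> * complex_of_real (x \<bullet> (t + s *\<^sub>R e))) * f x) has_vector_derivative
      (LINT x|lborel. exp (2 * pi * \<i> * complex_of_real (x \<bullet> (t + 0 *\<^sub>R e))) * (2 * pi * \<i> * (complex_of_real (x \<bullet> e) * f x)))) (at 0)"
  proof (rule has_vector_derivative_lebesgue_integral(2)
      [where k' = "\<lambda>s x. exp (2 * pi * \<i> * complex_of_real (x \<bullet> (t + s *\<^sub>R e))) * (2 * pi * \<i> * (complex_of_real (x \<bullet> e) * f x))"
        and w = "\<lambda>x. norm (2 * pi * \<i> * (complex_of_real (x \<bullet> e) * f x))"])
    show "integrable lborel (\<lambda>x. exp (2 * pi * \<i> * complex_of_real (x \<bullet> (t + 0 *\<^sub>R e))) * f x)"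
      by (rule Bochner_Integration.integrable_bound[OF rapid_integrable[OF assms]]) (auto simp: norm_mult)
    fix s :: real and x :: "real^'n"
    have "((\<lambda>s. exp (2 * pi * \<i> * complex_of_real ((t + s *\<^sub>R e) \<bullet> x))) has_vector_derivative
        2 * pi * \<i> * complex_of_real (e \<bullet> x) * exp (2 * pi * \<i> * complex_of_real ((t + s *\<^sub>R e) \<bullet> x))) (at s)"
      by (rule has_dirderiv_along[OF has_dirderiv_character])
    from has_vector_derivative_mult[OF this has_vector_derivative_const[of "f x"]]
    show "((\<lambda>s. exp (2 * pi * \<i> * complex_of_real (x \<bullet> (t + s *\<^sub>R e))) * f x) has_vector_derivative
       exp (2 * pi * \<i> * complex_of_real (x \<bullet> (t + s *\<^sub>R e))) * (2 * pi * \<i> * (complex_of_real (x \<bullet> e) * f x))) (at s)"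
      by (simp add: inner_commute mult_ac)
    show "norm (exp (2 * pi * \<i> * complex_of_real (x \<bullet> (t + s *\<^sub>R e))) * (2 * pi * \<i> * (complex_of_real (x \<bullet> e) * f x)))
      \<le> norm (2 * pi * \<i> * (complex_of_real (x \<bullet> e) * f x))"
      by (simp only: norm_mult[of "exp _"] norm_character)
  qed (use int in \<open>auto simp: integrable_norm\<close>)
  then show ?thesis
    by (simp add: has_dirderiv_def ifourier_def)
qed

text \<open>An axis derivative of \<open>ifourier f\<close> is \<open>ifourier\<close> of a multiple
  of x_j f, which is again \<open>rapid\<close>; hence an induction on the order with f
  arbitrary.\<close>

lemma rapid_ifourier:
  assumes "rapid f"
  shows "rapid (ifourier f)"
proof -
  have "\<exists>C. dbound (axis j 1) UNIV L (ifourier f) (\<lambda>x. C / (1 + norm x) ^ M)" for j L M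
    using assms
  proof (induction L arbitrary: f)
    case 0
    then show ?case using rapid_ifourier_decay[of f M] by auto
  next
    case (Suc L)
    define f' where "f' = (\<lambda>x. 2 * pi * \<i> * (complex_of_real (x \<bullet> axis j 1) * f x))"
    have "rapid f'"
      unfolding f'_def by (intro rapid_cmult rapid_mult_coord Suc.prems)
    then obtain C2 where C2: "dbound (axis j 1) UNIV L (ifourier f') (\<lambda>x. C2 / (1 + norm x) ^ M)"
      using Suc.IH by blast
    obtain C1 where C1: "\<And>x. norm (ifourier f x) \<le> C1 / (1 + norm x) ^ M"
      using rapid_ifourier_decay[OF Suc.prems] by blast
    have le: "C1 / (1 + norm x) ^ M \<le> max C1 C2 / (1 + norm x) ^ M" "C2 / (1 + norm x) ^ M \<le> max C1 C2 / (1 + norm x) ^ M"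
      for x :: "real^'a" by (auto intro!: divide_right_mono)
    have "dbound (axis j 1) UNIV (Suc L) (ifourier f) (\<lambda>x. max C1 C2 / (1 + norm x) ^ M)"
      by (rule dbound_Suc_cong[where f' = "ifourier f'"])
        (use has_dirderiv_ifourier[OF Suc.prems, of "axis j 1"] dbound_mono[OF C2 le(2)] order_trans[OF C1 le(1)]
          in \<open>auto simp: f'_def\<close>)
    then show ?case by blast
  qed
  then show ?thesis
    unfolding rapid_def using measurable_ifourier[OF rapid_measurable[OF assms]] by blast
qed

section \<open>Derivatives of the homogeneous phase\<close>

locale homogeneous_phase =
  fixes \<mu> :: "real^'n::finite \<Rightarrow> real" and m :: real
  assumes smooth: "smooth_on (- {0}) \<mu>"
    and m_ge: "m \<ge> 2"
    and homog: "\<And>t x. t > 0 \<Longrightarrow> x \<noteq> 0 \<Longrightarrow> \<mu> (t *\<^sub>R x) = t powr m * \<mu> x"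
    and hess: "\<And>x. norm x = 1 \<Longrightarrow> det (\<chi> i j. iter_partial [i, j] \<mu> x) \<noteq> 0"
begin

lemma differentiable_iter_partial: "x \<noteq> 0 \<Longrightarrow> iter_partial is \<mu> differentiable (at x)"
  using smooth by (auto simp: smooth_on_def)

lemma continuous_iter_partial: "continuous_on (- {0}) (iter_partial is \<mu>)"
  by (intro continuous_at_imp_continuous_on ballI differentiable_imp_continuous_within
      differentiable_iter_partial) auto

text \<open>Each derivative lowers the degree by one. With the parameter rescaled to s / t, dilation
  by t maps x + (s/t) e to t x + s e, so the derivatives at x and at t x can be compared.\<close>

lemma iter_partial_homog:
  assumes "0 < t" "x \<noteq> 0"
  shows "iter_partial is \<mu> (t *\<^sub>R x) = t powr (m - length is) * iter_partial is \<mu> x"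
  using assms(2)
proof (induction "is" arbitrary: x)
  case Nil
  then show ?case using homog[OF assms(1)] by simp
next
  case (Cons i "is")
  define f where "f = iter_partial is \<mu>"
  define e where "e = (axis i 1 :: real^'n)"
  define d where "d = iter_partial (i # is) \<mu>"
  have der: "((\<lambda>s. f (u + s *\<^sub>R e)) has_vector_derivative d u) (at 0)" if "u \<noteq> 0" for u
    using has_dirderiv_iter_partial[OF smooth, of u i "is"] that
    by (simp add: has_dirderiv_def f_def e_def d_def)
  have "((\<lambda>s. f (x + s *\<^sub>R e)) \<circ> (\<lambda>s. s / t) has_vector_derivative (1 / t) *\<^sub>R d x) (at 0)"
    by (rule vector_diff_chain_at)
      (use der[OF Cons.prems] assms(1) in \<open>auto intro!: derivative_eq_intros simp: has_real_derivative_iff_has_vector_derivative[symmetric]\<close>)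
  then have "((\<lambda>s. t powr (m - length is) * f (x + (s / t) *\<^sub>R e)) has_vector_derivative
      t powr (m - length is) * ((1 / t) *\<^sub>R d x)) (at 0)"
    unfolding comp_def by (rule has_vector_derivative_mult_right)
  then have "((\<lambda>s. f (t *\<^sub>R x + s *\<^sub>R e)) has_vector_derivative t powr (m - length is) * ((1 / t) *\<^sub>R d x)) (at 0)"
  proof (rule has_vector_derivative_transform_within_open)
    show "open ((\<lambda>s. x + (s / t) *\<^sub>R e) -` (- {0}))"
      using assms(1) by (intro open_vimage continuous_intros) auto
    fix s assume "s \<in> (\<lambda>s. x + (s / t) *\<^sub>R e) -` (- {0})"
    then have "f (t *\<^sub>R (x + (s / t) *\<^sub>R e)) = t powr (m - length is) * f (x + (s / t) *\<^sub>R e)"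
      unfolding f_def by (intro Cons.IH) auto
    then show "t powr (m - length is) * f (x + (s / t) *\<^sub>R e) = f (t *\<^sub>R x + s *\<^sub>R e)"
      using assms(1) by (simp add: scaleR_add_right)
  qed (use Cons.prems in auto)
  moreover have "((\<lambda>s. f (t *\<^sub>R x + s *\<^sub>R e)) has_vector_derivative d (t *\<^sub>R x)) (at 0)"
    using der[of "t *\<^sub>R x"] assms(1) Cons.prems by simp
  ultimately have "d (t *\<^sub>R x) = t powr (m - length is) * ((1 / t) *\<^sub>R d x)"
    by (metis vector_derivative_at)
  also have "\<dots> = t powr (m - length (i # is)) * d x"
  proof -
    have "m - length (i # is) = (m - length is) - 1" by simp
    then show ?thesis using assms(1) by (simp add: powr_diff powr_add)
  qed
  finally show ?case by (simp add: d_def)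
qed

text \<open>Homogeneity reduces the estimate to the unit sphere, where compactness supplies the
  constant.\<close>

lemma iter_partial_bound:
  obtains C where "0 \<le> C" "\<And>x. x \<noteq> 0 \<Longrightarrow> \<bar>iter_partial is \<mu> x\<bar> \<le> C * norm x powr (m - length is)"
proof -
  have "compact (iter_partial is \<mu> ` sphere 0 1)"
    by (intro compact_continuous_image continuous_on_subset[OF continuous_iter_partial]) auto
  then obtain C where "\<forall>u\<in>sphere 0 1. \<bar>iter_partial is \<mu> u\<bar> \<le> C"
    using compact_imp_bounded[of "iter_partial is \<mu> ` sphere 0 1"] by (auto simp: bounded_iff)
  then have C: "\<bar>iter_partial is \<mu> u\<bar> \<le> C" if "norm u = 1" for u
    using that by simp
  show thesis
  proof
    show "0 \<le> \<bar>C\<bar>" by simp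
    fix x :: "real^'n" assume x: "x \<noteq> 0"
    define u where "u = (1 / norm x) *\<^sub>R x"
    have u: "norm u = 1" "x = norm x *\<^sub>R u" "u \<noteq> 0" using x by (auto simp: u_def)
    have "iter_partial is \<mu> x = norm x powr (m - length is) * iter_partial is \<mu> u"
      using iter_partial_homog[of "norm x" u "is"] u x by simp
    then show "\<bar>iter_partial is \<mu> x\<bar> \<le> \<bar>C\<bar> * norm x powr (m - length is)"
      using order_trans[OF C[OF u(1)] abs_ge_self] by (simp add: abs_mult mult.commute mult_right_mono)
  qed
qed

definition grad :: "real^'n \<Rightarrow> real^'n" where
  "grad x = (\<chi> i. iter_partial [i] \<mu> x)"

text \<open>The derivative of \<open>grad\<close> at x along v. The outer partial derivative is
  contracted with v, so this identification involves no symmetry of mixed partials; as a matrix it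
  is the transpose of the one in the determinant condition.\<close>

definition hmap :: "real^'n \<Rightarrow> real^'n \<Rightarrow> real^'n" where
  "hmap x v = (\<chi> j. \<Sum>i\<in>UNIV. v $ i * iter_partial [i, j] \<mu> x)"

lemma has_dirderiv_iter_partial_any:
  assumes "x \<noteq> 0"
  shows "has_dirderiv v (iter_partial is \<mu>) x (\<Sum>i\<in>UNIV. v $ i * iter_partial (i # is) \<mu> x)"
proof -
  let ?F = "frechet_derivative (iter_partial is \<mu>) (at x)"
  have lin: "linear ?F" by (rule linear_frechet_derivative[OF differentiable_iter_partial[OF assms]])
  have "?F v = ?F (\<Sum>i\<in>UNIV. v $ i *\<^sub>R axis i 1)"
    by (simp add: basis_expansion scalar_mult_eq_scaleR[symmetric])
  also have "\<dots> = (\<Sum>i\<in>UNIV. v $ i * iter_partial (i # is) \<mu> x)"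
    using lin by (simp add: linear_sum linear_cmul partial_deriv_def)
  finally show ?thesis
    using has_dirderiv_of_differentiable[OF differentiable_iter_partial[OF assms]] by metis
qed

lemma has_dirderiv_grad:
  assumes "x \<noteq> 0"
  shows "has_dirderiv v (\<lambda>x. b \<bullet> grad x) x (b \<bullet> hmap x v)"
proof -
  have "((\<lambda>s. \<Sum>j\<in>UNIV. b $ j * iter_partial [j] \<mu> (x + s *\<^sub>R v)) has_vector_derivative
      (\<Sum>j\<in>UNIV. b $ j * (\<Sum>i\<in>UNIV. v $ i * iter_partial [i, j] \<mu> x))) (at 0)"
    using has_dirderiv_iter_partial_any[OF assms, of v] unfolding has_dirderiv_def
    by (intro has_vector_derivative_sum has_vector_derivative_mult_right) blast
  then show ?thesis
    by (simp add: has_dirderiv_def grad_def hmap_def inner_vec_def)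
qed

lemma hmap_homog:
  assumes "x \<noteq> 0"
  shows "hmap x v = norm x powr (m - 2) *\<^sub>R hmap ((1 / norm x) *\<^sub>R x) v"
proof -
  have "iter_partial [i, j] \<mu> x = norm x powr (m - 2) * iter_partial [i, j] \<mu> ((1 / norm x) *\<^sub>R x)" for i j
    using iter_partial_homog[of "norm x" "(1 / norm x) *\<^sub>R x" "[i, j]"] assms by simp
  then show ?thesis
    unfolding hmap_def by (simp add: vec_eq_iff sum_distrib_left mult_ac)
qed

section \<open>Expansion of the gradient map on narrow cones\<close>

lemma hmap_bounded_below:
  assumes "norm e = 1"
  obtains B where "0 < B" "\<And>v. B * norm v \<le> norm (hmap e v)"
proof -
  define H where "H = transpose (\<chi> i j. iter_partial [i, j] \<mu> e)"
  have H: "hmap e v = H *v v" for v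
    by (simp add: hmap_def H_def matrix_vector_mult_def transpose_def mult.commute)
  have "invertible H"
    using hess[OF assms] by (simp add: H_def invertible_det_nz det_transpose)
  then have "inj ((*v) H)" by (rule inj_matrix_vector_mult)
  then show thesis
    using linear_inj_bounded_below_pos[OF matrix_vector_mul_linear] that H by metis
qed

lemma hmap_diff_le:
  "norm (hmap x v - hmap e v) \<le> (\<Sum>j\<in>UNIV. \<Sum>i\<in>UNIV. \<bar>iter_partial [i, j] \<mu> x - iter_partial [i, j] \<mu> e\<bar>) * norm v"
proof -
  have "norm (hmap x v - hmap e v) \<le> (\<Sum>j\<in>UNIV. \<bar>(hmap x v - hmap e v) $ j\<bar>)"
    by (rule norm_le_l1_cart)
  also have "\<dots> \<le> (\<Sum>j\<in>UNIV. \<Sum>i\<in>UNIV. \<bar>iter_partial [i, j] \<mu> x - iter_partial [i, j] \<mu> e\<bar> * norm v)"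
  proof (rule sum_mono)
    fix j
    have "(hmap x v - hmap e v) $ j = (\<Sum>i\<in>UNIV. (iter_partial [i, j] \<mu> x - iter_partial [i, j] \<mu> e) * v $ i)"
      by (simp add: hmap_def sum_subtractf[symmetric] algebra_simps)
    also have "\<bar>\<dots>\<bar> \<le> (\<Sum>i\<in>UNIV. \<bar>(iter_partial [i, j] \<mu> x - iter_partial [i, j] \<mu> e) * v $ i\<bar>)"
      by (rule sum_abs)
    also have "\<dots> \<le> (\<Sum>i\<in>UNIV. \<bar>iter_partial [i, j] \<mu> x - iter_partial [i, j] \<mu> e\<bar> * norm v)"
      unfolding abs_mult by (intro sum_mono mult_left_mono component_le_norm_cart) auto
    finally show "\<bar>(hmap x v - hmap e v) $ j\<bar> \<le> (\<Sum>i\<in>UNIV. \<bar>iter_partial [i, j] \<mu> x - iter_partial [i, j] \<mu> e\<bar> * norm v)" .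
  qed
  finally show ?thesis by (simp add: sum_distrib_right)
qed

text \<open>The sum of the entrywise differences dominates the operator norm and is continuous at
  \<open>e\<close>, so \<open>\<eta>\<close> does not depend on v.\<close>

lemma hmap_continuous:
  assumes "norm e = 1" "0 < \<epsilon>"
  obtains \<eta> where "0 < \<eta>" "\<eta> \<le> 1" "\<And>x v. norm (x - e) < \<eta> \<Longrightarrow> norm (hmap x v - hmap e v) \<le> \<epsilon> * norm v"
proof -
  let ?s = "\<lambda>x. \<Sum>j\<in>UNIV. \<Sum>i\<in>UNIV. \<bar>iter_partial [i, j] \<mu> x - iter_partial [i, j] \<mu> e\<bar>"
  have "isCont (iter_partial is \<mu>) e" for "is"
    using assms(1) by (intro differentiable_imp_continuous_within differentiable_iter_partial) auto
  then have "isCont ?s e"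
    by (intro continuous_intros)
  then have "(?s \<longlongrightarrow> ?s e) (at e)" by (simp only: isCont_def)
  then have "\<forall>\<^sub>F x in at e. dist (?s x) (?s e) < \<epsilon>"
    using assms(2) by (rule tendstoD)
  then obtain d where d: "0 < d" "\<And>x. x \<noteq> e \<Longrightarrow> dist x e < d \<Longrightarrow> dist (?s x) (?s e) < \<epsilon>"
    by (auto simp only: eventually_at)
  show thesis
  proof
    fix x v assume x: "norm (x - e) < min d 1"
    have "?s x \<le> \<epsilon>"
    proof (cases "x = e")
      case False
      have "?s x \<le> \<bar>?s x - ?s e\<bar>" by simp
      also have "\<dots> \<le> \<epsilon>"
        using d(2)[OF False] x by (simp only: dist_norm real_norm_def min_less_iff_conj less_imp_le)
      finally show ?thesis .
    qed (use assms(2) in simp)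
    then show "norm (hmap x v - hmap e v) \<le> \<epsilon> * norm v"
      by (intro order_trans[OF hmap_diff_le] mult_right_mono) auto
  qed (use d(1) in auto)
qed

text \<open>On a narrow cone the Hessian is a positive scalar times a small perturbation of one fixed
  invertible matrix, so pairing the gradient with the image of the increment under that matrix gives a
  function that increases along segments.\<close>
lemma grad_cone_lower_bound:
  assumes e: "norm e = 1"
  shows "\<exists>\<kappa> c. \<kappa> < 1 \<and> 0 < c \<and> (\<forall>z z0. z \<bullet> e > \<kappa> * norm z \<longrightarrow> z0 \<bullet> e > \<kappa> * norm z0 \<longrightarrow>
    c * norm z powr (m - 2) * norm (z - z0) \<le> norm (grad z - grad z0))"
proof -
  obtain B where B: "0 < B" "\<And>v. B * norm v \<le> norm (hmap e v)"
    using hmap_bounded_below[OF e] by blast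
  \<comment> \<open>Half of the lower bound \<open>B\<close> is given up to the perturbation of the
    Hessian; \<open>\<epsilon>\<close> is the half that remains.\<close>
  define \<epsilon> where "\<epsilon> = B / 2"
  have \<epsilon>: "0 < \<epsilon>" using B(1) by (simp add: \<epsilon>_def)
  obtain \<eta> where \<eta>: "0 < \<eta>" "\<eta> \<le> 1" "\<And>x v. norm (x - e) < \<eta> \<Longrightarrow> norm (hmap x v - hmap e v) \<le> \<epsilon> * norm v"
    using hmap_continuous[OF e \<epsilon>] by blast
  \<comment> \<open>For a unit vector u, |u - e|^2 = 2 - 2 u.e, so u.e > \<kappa> means |u - e| <
    \<eta>. Since \<eta> \<le> 1, also \<kappa> \<ge> 1/2; nonnegativity makes the cone
    convex.\<close>
  define \<kappa> where "\<kappa> = 1 - \<eta>\<^sup>2 / 2"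
  have \<kappa>: "1 / 2 \<le> \<kappa>" "\<kappa> < 1"
    using \<eta> power_le_one[of \<eta> 2] by (auto simp: \<kappa>_def)
  \<comment> \<open>The factor 1/2 is the length of the parameter interval [1/2, 1] on which growth
    is measured; inside it |X s| \<ge> |z| / 4.\<close>
  define c where "c = \<epsilon> / 2 * (1 / 4) powr (m - 2)"
  have c: "0 < c" using \<epsilon> by (simp add: c_def)
  have nz: "x \<noteq> 0" if "x \<bullet> e > \<kappa> * norm x" for x using that by auto
  have near: "norm (hmap x v - norm x powr (m - 2) *\<^sub>R hmap e v) \<le> norm x powr (m - 2) * (\<epsilon> * norm v)"
    if x: "x \<bullet> e > \<kappa> * norm x" for x v
  proof -
    define u where "u = (1 / norm x) *\<^sub>R x"
    have "norm u = 1" using nz[OF x] by (simp add: u_def)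
    then have "(norm (u - e))\<^sup>2 = 2 - 2 * (u \<bullet> e)"
      using e by (simp add: power2_norm_eq_inner inner_diff_left inner_diff_right inner_commute
          norm_eq_1)
    moreover have "u \<bullet> e > \<kappa>"
      using x nz[OF x] by (simp add: u_def pos_less_divide_eq)
    ultimately have "(norm (u - e))\<^sup>2 < \<eta>\<^sup>2" by (simp add: \<kappa>_def field_simps)
    then have "norm (u - e) < \<eta>" using \<eta>(1) by (simp add: power2_less_imp_less)
    then have "norm (hmap u v - hmap e v) \<le> \<epsilon> * norm v" by (rule \<eta>(3))
    moreover have "hmap x v - norm x powr (m - 2) *\<^sub>R hmap e v = norm x powr (m - 2) *\<^sub>R (hmap u v - hmap e v)"
      using hmap_homog[OF nz[OF x], of v] by (simp add: u_def scaleR_diff_right)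
    ultimately show ?thesis by (simp add: mult_left_mono)
  qed
  have main: "c * norm z powr (m - 2) * norm (z - z0) \<le> norm (grad z - grad z0)"
    if z: "z \<bullet> e > \<kappa> * norm z" and z0: "z0 \<bullet> e > \<kappa> * norm z0" for z z0
  proof (cases "z = z0")
    case False
    define v where "v = z - z0"
    have v: "v \<noteq> 0" using False by (simp add: v_def)
    define b where "b = (1 / norm (hmap e v)) *\<^sub>R hmap e v"
    have hv: "0 < norm (hmap e v)" using B(2)[of v] B(1) v
      by (meson less_le_trans mult_pos_pos zero_less_norm_iff)
    have b: "norm b = 1" "b \<bullet> hmap e v = norm (hmap e v)"
      using hv by (auto simp: b_def power2_norm_eq_inner[symmetric] power2_eq_square)
    define X where "X s = z0 + s *\<^sub>R v" for s
    \<comment> \<open>Convexity keeps the segment from z0 to z in the cone, hence off the origin and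
      within reach of the perturbation estimate.\<close>
    have X: "X s \<bullet> e > \<kappa> * norm (X s)" "X s \<bullet> e \<ge> s * (z \<bullet> e)" if s: "0 \<le> s" "s \<le> 1" for s
    proof -
      have Xs: "X s = (1 - s) *\<^sub>R z0 + s *\<^sub>R z"
        by (simp add: X_def v_def algebra_simps)
      have "norm (X s) \<le> (1 - s) * norm z0 + s * norm z"
        unfolding Xs using s norm_triangle_ineq[of "(1 - s) *\<^sub>R z0" "s *\<^sub>R z"] by simp
      then have "\<kappa> * norm (X s) \<le> (1 - s) * (\<kappa> * norm z0) + s * (\<kappa> * norm z)"
        using mult_left_mono[of "norm (X s)" "(1 - s) * norm z0 + s * norm z" \<kappa>] \<kappa> by (simp add: algebra_simps)
      also have "\<dots> < (1 - s) * (z0 \<bullet> e) + s * (z \<bullet> e)"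
      proof (cases "s = 0")
        case False
        then show ?thesis
          using s z z0 by (intro add_le_less_mono mult_left_mono mult_strict_left_mono) auto
      qed (use z0 in simp)
      also have "\<dots> = X s \<bullet> e" by (simp add: Xs inner_add_left)
      finally show "X s \<bullet> e > \<kappa> * norm (X s)" .
      have "0 \<le> \<kappa> * norm z0" using \<kappa> by simp
      then have "0 \<le> z0 \<bullet> e" using z0 by linarith
      then show "X s \<bullet> e \<ge> s * (z \<bullet> e)"
        using s by (simp add: Xs inner_add_left)
    qed
    define \<phi> where "\<phi> s = b \<bullet> grad (X s)" for s
    define \<phi>' where "\<phi>' s = b \<bullet> hmap (X s) v" for s
    have der: "(\<phi> has_real_derivative \<phi>' s) (at s)" if "0 \<le> s" "s \<le> 1" for s
      using has_dirderiv_along[OF has_dirderiv_grad[OF nz[OF X(1)[OF that, unfolded X_def]], of v b]]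
      by (simp add: has_real_derivative_iff_has_vector_derivative \<phi>_def[abs_def] \<phi>'_def X_def)
    have lower: "\<phi>' s \<ge> norm (X s) powr (m - 2) * (\<epsilon> * norm v)" if "0 \<le> s" "s \<le> 1" for s
    proof -
      define N where "N = norm (X s) powr (m - 2)"
      have "\<bar>b \<bullet> (hmap (X s) v - N *\<^sub>R hmap e v)\<bar> \<le> N * (\<epsilon> * norm v)"
        using Cauchy_Schwarz_ineq2[of b "hmap (X s) v - N *\<^sub>R hmap e v"] b(1) near[OF X(1)[OF that], of v]
        by (simp add: N_def)
      then have "b \<bullet> hmap (X s) v \<ge> N * norm (hmap e v) - N * (\<epsilon> * norm v)"
        using b(2) by (simp add: inner_diff_right)
      moreover have "N * norm (hmap e v) \<ge> N * (2 * \<epsilon> * norm v)"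
        using B(2)[of v] by (intro mult_left_mono) (auto simp: N_def \<epsilon>_def)
      ultimately show ?thesis by (simp add: \<phi>'_def N_def algebra_simps)
    qed
    \<comment> \<open>Near s = 0 the segment may be much closer to the origin than z is, because
      |z0| is arbitrary. Only monotonicity is used on this half; the quantitative growth comes from
      the other one.\<close>
    have "\<phi> 0 \<le> \<phi> (1 / 2)"
    proof (rule DERIV_nonneg_imp_nondecreasing[where f = \<phi> and a = 0])
      fix s :: real assume "0 \<le> s" "s \<le> 1 / 2"
      then have s: "0 \<le> s" "s \<le> 1" by auto
      have "0 \<le> \<phi>' s" using \<epsilon> by (intro order_trans[OF _ lower[OF s]]) simp
      then show "\<exists>y. DERIV \<phi> s :> y \<and> 0 \<le> y" using der[OF s] by blast
    qed simp
    moreover have "\<phi> 1 - \<phi> (1 / 2) \<ge> c * norm z powr (m - 2) * norm v"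
    proof -
      have "\<exists>s. 1 / 2 < s \<and> s < 1 \<and> \<phi> 1 - \<phi> (1 / 2) = (1 - 1 / 2) * \<phi>' s"
        by (rule MVT2) (use der in auto)
      then obtain s where s: "1 / 2 < s" "s < 1" "\<phi> 1 - \<phi> (1 / 2) = \<phi>' s / 2" by auto
      have "norm z / 4 \<le> norm (X s)"
      proof -
        have "norm z / 4 = (1 / 2) * ((1 / 2) * norm z)" by simp
        also have "\<dots> \<le> s * (\<kappa> * norm z)"
          using s \<kappa> by (intro mult_mono) auto
        also have "\<dots> \<le> s * (z \<bullet> e)"
          using s z by (intro mult_left_mono) auto
        also have "\<dots> \<le> X s \<bullet> e" using X(2)[of s] s by simp
        also have "\<dots> \<le> norm (X s)"
          using Cauchy_Schwarz_ineq2[of "X s" e] e by simp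
        finally show ?thesis .
      qed
      then have "(norm z / 4) powr (m - 2) \<le> norm (X s) powr (m - 2)"
        using m_ge by (intro powr_mono2) auto
      then have "(norm z / 4) powr (m - 2) * (\<epsilon> * norm v) \<le> norm (X s) powr (m - 2) * (\<epsilon> * norm v)"
        using \<epsilon> by (intro mult_right_mono) auto
      also have "\<dots> \<le> \<phi>' s" using lower[of s] s by simp
      finally have "(norm z / 4) powr (m - 2) * (\<epsilon> * norm v) \<le> \<phi>' s" .
      moreover have "(norm z / 4) powr (m - 2) = (1 / 4) powr (m - 2) * norm z powr (m - 2)"
        using powr_mult[of "1 / 4" "norm z" "m - 2"] by simp
      ultimately show ?thesis using s(3) by (simp add: c_def algebra_simps)
    qed
    moreover have "\<phi> 1 - \<phi> 0 \<le> norm (grad z - grad z0)"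
    proof -
      have "\<phi> 1 - \<phi> 0 = b \<bullet> (grad z - grad z0)"
        by (simp add: \<phi>_def X_def v_def inner_diff_right)
      also have "\<dots> \<le> norm b * norm (grad z - grad z0)" by (rule norm_cauchy_schwarz)
      finally show ?thesis using b by simp
    qed
    ultimately show ?thesis by (simp add: v_def)
  qed simp
  show ?thesis using main \<kappa> c by blast
qed

text \<open>As \<kappa> e < 1, each unit vector lies in its own open cone, so finitely many cones
  cover the compact sphere and, by scaling, everything but the origin.\<close>

lemma cone_cover:
  "\<exists>D \<kappa> (c::real). finite D \<and> D \<subseteq> sphere 0 1 \<and> 0 < c \<and> (\<forall>e\<in>D. \<kappa> e < 1) \<and>
    (\<forall>x. x \<noteq> 0 \<longrightarrow> (\<exists>e\<in>D. x \<bullet> e > \<kappa> e * norm x)) \<and>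
    (\<forall>e\<in>D. \<forall>z z0. z \<bullet> e > \<kappa> e * norm z \<longrightarrow> z0 \<bullet> e > \<kappa> e * norm z0 \<longrightarrow>
       c * norm z powr (m - 2) * norm (z - z0) \<le> norm (grad z - grad z0))"
proof -
  have "\<forall>e. \<exists>\<kappa> c. norm e = 1 \<longrightarrow> \<kappa> < 1 \<and> 0 < c \<and> (\<forall>z z0. z \<bullet> e > \<kappa> * norm z \<longrightarrow> z0 \<bullet> e > \<kappa> * norm z0 \<longrightarrow>
    c * norm z powr (m - 2) * norm (z - z0) \<le> norm (grad z - grad z0))"
    using grad_cone_lower_bound by meson
  then obtain \<kappa> c where kc: "\<And>e. norm e = 1 \<Longrightarrow> \<kappa> e < 1 \<and> 0 < c e \<and> (\<forall>z z0. z \<bullet> e > \<kappa> e * norm z \<longrightarrow> z0 \<bullet> e > \<kappa> e * norm z0 \<longrightarrow>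
    c e * norm z powr (m - 2) * norm (z - z0) \<le> norm (grad z - grad z0))"
    by metis
  define U where "U e = {x. x \<bullet> e > \<kappa> e * norm x}" for e
  have "open (U e)" for e
    unfolding U_def by (intro open_Collect_less continuous_intros)
  moreover have "sphere 0 1 \<subseteq> (\<Union>e\<in>sphere 0 1. U e)"
  proof
    fix x :: "real^'n" assume "x \<in> sphere 0 1"
    then have "norm x = 1" by simp
    then have "x \<in> U x" using kc[of x] by (simp add: U_def dot_square_norm)
    then show "x \<in> (\<Union>e\<in>sphere 0 1. U e)" using \<open>norm x = 1\<close> by auto
  qed
  ultimately obtain D where D: "D \<subseteq> sphere 0 1" "finite D" "sphere 0 1 \<subseteq> (\<Union>e\<in>D. U e)"
    using compactE_image[OF compact_sphere[of "0 :: real^'n" 1], of "sphere 0 1" U] by blast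
  have D1: "norm e = 1" if "e \<in> D" for e using that D(1) by auto
  \<comment> \<open>Inserting 1 makes the set nonempty, so that \<open>Min\<close> is meaningful
    without knowing that \<open>D\<close> is nonempty.\<close>
  define c0 where "c0 = Min (insert 1 (c ` D))"
  have c0: "0 < c0" "\<And>e. e \<in> D \<Longrightarrow> c0 \<le> c e"
    using D(2) kc D1 by (auto simp: c0_def)
  show ?thesis
  proof (intro exI[of _ D] exI[of _ \<kappa>] exI[of _ c0] conjI ballI allI impI)
    show "\<exists>e\<in>D. x \<bullet> e > \<kappa> e * norm x" if x: "x \<noteq> 0" for x
    proof -
      have "(1 / norm x) *\<^sub>R x \<in> sphere 0 1" using x by simp
      then obtain e where "e \<in> D" "(1 / norm x) *\<^sub>R x \<in> U e" using D(3) by blast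
      then show ?thesis using x by (auto simp: U_def pos_less_divide_eq)
    qed
    show "c0 * norm z powr (m - 2) * norm (z - z0) \<le> norm (grad z - grad z0)"
      if "e \<in> D" "z \<bullet> e > \<kappa> e * norm z" "z0 \<bullet> e > \<kappa> e * norm z0" for e z z0
    proof -
      have "c0 * norm z powr (m - 2) * norm (z - z0) \<le> c e * norm z powr (m - 2) * norm (z - z0)"
        using c0(2)[OF that(1)] by (intro mult_right_mono) auto
      also have "\<dots> \<le> norm (grad z - grad z0)" using kc[OF D1[OF that(1)]] that(2,3) by blast
      finally show ?thesis .
    qed
  qed (use D D1 kc c0 in auto)
qed

text \<open>Here \<open>p e\<close> minimises |grad + y| over the cone of e up to an error 1, as the
  infimum need not be attained. The triangle inequality gives c N |z - p e| \<le> 2 |grad z + y| + 1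
  with N = |z|^(m-2), and 1 \<le> N absorbs the error on division by N. The points depend on y, but
  \<open>D\<close> and \<open>c\<close> do not.\<close>

lemma grad_shift_weight:
  obtains D :: "(real^'n) set" and c :: real where "finite D" "0 < c"
    "\<And>y. \<exists>p. \<forall>z. norm z \<ge> 1 \<longrightarrow> (\<exists>e\<in>D. 1 + c * norm (z - p e) \<le> 2 * (1 + norm (grad z + y) / norm z powr (m - 2)))"
proof -
  obtain D \<kappa> and c :: real where D: "finite D" "D \<subseteq> sphere 0 1" "0 < c"
    "\<And>e. e \<in> D \<Longrightarrow> \<kappa> e < 1"
    "\<And>x. x \<noteq> 0 \<Longrightarrow> \<exists>e\<in>D. x \<bullet> e > \<kappa> e * norm x"
    "\<And>e z z0. e \<in> D \<Longrightarrow> z \<bullet> e > \<kappa> e * norm z \<Longrightarrow> z0 \<bullet> e > \<kappa> e * norm z0 \<Longrightarrow>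
       c * norm z powr (m - 2) * norm (z - z0) \<le> norm (grad z - grad z0)"
    using cone_cover by metis
  have ex: "\<exists>p. \<forall>z. norm z \<ge> 1 \<longrightarrow> (\<exists>e\<in>D. 1 + c * norm (z - p e) \<le> 2 * (1 + norm (grad z + y) / norm z powr (m - 2)))" for y
  proof -
    define U where "U e = {x. x \<bullet> e > \<kappa> e * norm x}" for e
    have "\<exists>q. q \<in> U e \<and> (\<forall>z\<in>U e. norm (grad q + y) \<le> norm (grad z + y) + 1)" if e: "e \<in> D" for e
    proof -
      define V where "V = (\<lambda>z. norm (grad z + y)) ` U e"
      have "norm e = 1" using e D(2) by auto
      then have "e \<in> U e" using D(4)[OF e] by (simp add: U_def dot_square_norm)
      then have "V \<noteq> {}" by (auto simp: V_def)
      moreover have bdd: "bdd_below V" unfolding V_def by (rule bdd_belowI2[of _ 0]) simp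
      ultimately obtain a where a: "a \<in> V" "a < Inf V + 1"
        using cInf_lessD[of V "Inf V + 1"] by auto
      then obtain q where q: "q \<in> U e" "a = norm (grad q + y)" by (auto simp: V_def)
      have "norm (grad q + y) \<le> norm (grad z + y) + 1" if "z \<in> U e" for z
        using cInf_lower[OF _ bdd, of "norm (grad z + y)"] that a(2) q(2) by (auto simp: V_def)
      then show ?thesis using q by blast
    qed
    then obtain p where p: "\<And>e. e \<in> D \<Longrightarrow> p e \<in> U e" "\<And>e z. e \<in> D \<Longrightarrow> z \<in> U e \<Longrightarrow> norm (grad (p e) + y) \<le> norm (grad z + y) + 1"
      by metis
    have "\<exists>e\<in>D. 1 + c * norm (z - p e) \<le> 2 * (1 + norm (grad z + y) / norm z powr (m - 2))" if z: "norm z \<ge> 1" for z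
    proof -
      have "z \<noteq> 0" using z by auto
      then obtain e where e: "e \<in> D" "z \<in> U e" using D(5)[of z] by (auto simp: U_def)
      define N where "N = norm z powr (m - 2)"
      have N: "1 \<le> N" using z m_ge by (simp add: N_def ge_one_powr_ge_zero)
      have "c * N * norm (z - p e) \<le> norm (grad z - grad (p e))"
        unfolding N_def by (rule D(6)[OF e(1)]) (use e p(1)[OF e(1)] in \<open>auto simp: U_def\<close>)
      also have "\<dots> \<le> norm (grad z + y) + norm (grad (p e) + y)"
        using norm_triangle_ineq4[of "grad z + y" "grad (p e) + y"] by simp
      also have "\<dots> \<le> 2 * norm (grad z + y) + N"
        using p(2)[OF e] N by linarith
      finally have "c * norm (z - p e) \<le> (2 * norm (grad z + y) + N) / N"
        using N by (simp add: pos_le_divide_eq mult_ac)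
      then have "c * norm (z - p e) \<le> 2 * (norm (grad z + y) / N) + 1"
        using N by (simp add: add_divide_distrib)
      then show ?thesis using e(1) by (intro bexI[of _ e]) (auto simp: N_def)
    qed
    then show ?thesis by blast
  qed
  show thesis by (rule that[OF D(1,3) ex])
qed

end

section \<open>A cutoff removing the singularity at the origin\<close>

text \<open>At s = 0 the difference quotient is max(0, h)^(k+1), which tends to 0 because the
  exponent is positive.\<close>

lemma DERIV_max_power:
  "((\<lambda>s::real. max 0 s ^ Suc (Suc k)) has_real_derivative real (Suc (Suc k)) * max 0 s ^ Suc k) (at s)"
proof -
  consider "0 < s" | "s < 0" | "s = 0" by linarith
  then show ?thesis
  proof cases
    case 1
    have "((\<lambda>s. s ^ Suc (Suc k)) has_real_derivative real (Suc (Suc k)) * s ^ Suc k) (at s)"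
      using DERIV_pow[of "Suc (Suc k)" s] by simp
    then have "((\<lambda>s. max 0 s ^ Suc (Suc k)) has_real_derivative real (Suc (Suc k)) * s ^ Suc k) (at s)"
      by (rule has_field_derivative_transform_within_open[of _ _ _ "{0<..}"]) (use 1 in auto)
    then show ?thesis using 1 by (simp add: max_def)
  next
    case 2
    have "((\<lambda>s. 0) has_real_derivative 0) (at s)" by simp
    then have "((\<lambda>s. max 0 s ^ Suc (Suc k)) has_real_derivative 0) (at s)"
      by (rule has_field_derivative_transform_within_open[of _ _ _ "{..<0}"]) (use 2 in auto)
    then show ?thesis using 2 by (simp add: max_def)
  next
    case 3
    have "((\<lambda>h::real. max 0 h ^ Suc k) \<longlongrightarrow> max 0 0 ^ Suc k) (at 0)"
      by (intro tendsto_intros)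
    then have "((\<lambda>h::real. max 0 h ^ Suc k) \<longlongrightarrow> 0) (at 0)" by simp
    then have "((\<lambda>h::real. (max 0 (0 + h) ^ Suc (Suc k) - max 0 0 ^ Suc (Suc k)) / h) \<longlongrightarrow> 0) (at 0)"
      by (rule Lim_transform_eventually) (auto simp: eventually_at_filter max_def)
    then show ?thesis by (simp add: 3 DERIV_def)
  qed
qed

lemma dbound_const_weight_mono: "dbound e S L f (\<lambda>_. B) \<Longrightarrow> B \<le> C \<Longrightarrow> dbound e S L f (\<lambda>_. C)"
  by (erule dbound_mono) auto

text \<open>Every derivative uses up one power of the truncated factor, so L < K leaves a positive
  exponent at the end.\<close>

lemma dbound_max_power:
  fixes f :: "'a::real_normed_vector \<Rightarrow> real"
  assumes "open S" "dbound e S L f (\<lambda>_. B)" "L < K"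
  shows "\<exists>C. dbound e S L (\<lambda>x. max 0 (f x) ^ K) (\<lambda>_. C)"
proof -
  have bound: "\<bar>max 0 (f x)\<bar> \<le> \<bar>B\<bar>" if "x \<in> S" for x
    using dbound_norm[OF assms(2) that] unfolding real_norm_def by linarith
  show ?thesis
    using assms(2,3)
  proof (induction L arbitrary: K)
    case 0
    have "norm (max 0 (f x) ^ K) \<le> \<bar>B\<bar> ^ K" if "x \<in> S" for x
      using bound[OF that] unfolding real_norm_def power_abs by (rule power_mono) simp
    then show ?case unfolding dbound.simps by blast
  next
    case (Suc L)
    define k where "k = K - 2"
    have K: "K = Suc (Suc k)" using Suc.prems(2) by (simp add: k_def)
    have "dbound e S L f (\<lambda>_. B)" by (rule dbound_le[OF Suc.prems(1)]) simp
    moreover have "L < Suc k" using Suc.prems(2) K by simp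
    ultimately obtain C1 where C1: "dbound e S L (\<lambda>x. max 0 (f x) ^ Suc k) (\<lambda>_. C1)"
      using Suc.IH by blast
    define f' where "f' x = real K * (max 0 (f x) ^ Suc k * dirderiv e f x)" for x
    have "dbound e S L f' (\<lambda>_. 2 ^ L * real K * (2 ^ L * C1 * B))"
      unfolding f'_def
      by (intro dbound_mult dbound_const assms C1) (use Suc.prems(1) in simp_all)
    then obtain C2 where C2: "dbound e S L f' (\<lambda>_. C2)" by blast
    define C where "C = max C2 (\<bar>B\<bar> ^ K)"
    have "dbound e S (Suc L) (\<lambda>x. max 0 (f x) ^ K) (\<lambda>_. C)"
    proof (rule dbound_Suc_cong[OF assms(1)])
      fix x assume x: "x \<in> S"
      have "\<bar>max 0 (f x) ^ K\<bar> \<le> \<bar>B\<bar> ^ K"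
        using bound[OF x] unfolding power_abs by (rule power_mono) simp
      then show "norm (max 0 (f x) ^ K) \<le> C" by (simp add: C_def)
      have 1: "((\<lambda>s. f (x + s *\<^sub>R e)) has_real_derivative dirderiv e f x) (at 0)"
        using Suc.prems x by (simp add: has_dirderiv_def has_real_derivative_iff_has_vector_derivative)
      have 2: "((\<lambda>s. max 0 s ^ K) has_real_derivative real K * max 0 (f (x + 0 *\<^sub>R e)) ^ Suc k) (at (f (x + 0 *\<^sub>R e)))"
        unfolding K by (rule DERIV_max_power)
      show "has_dirderiv e (\<lambda>x. max 0 (f x) ^ K) x (f' x)"
        using DERIV_chain2[OF 2 1]
        by (simp add: has_dirderiv_def has_real_derivative_iff_has_vector_derivative[symmetric] f'_def mult_ac)
    qed (rule dbound_const_weight_mono[OF C2], simp add: C_def)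
    then show ?case by blast
  qed
qed

text \<open>A piecewise polynomial step from 0 on the unit ball to 1 where |x|^2 \<ge> 2. Truncated
  K-th powers give K - 1 bounded derivatives along any line near the transition, which is enough for
  a fixed number of integrations by parts.\<close>

definition cutoff :: "nat \<Rightarrow> 'a::real_inner \<Rightarrow> real" where
  "cutoff K x = 1 - max 0 (1 - max 0 (x \<bullet> x - 1) ^ K) ^ K"

lemma cutoff_eq_0:
  assumes "norm x \<le> 1" "0 < K"
  shows "cutoff K x = 0"
proof -
  have "max 0 (x \<bullet> x - 1) = 0"
    using power_le_one[of "norm x" 2] assms(1) by (simp add: dot_square_norm)
  then show ?thesis using assms(2) by (simp add: cutoff_def zero_power)
qed

lemma cutoff_eq_1:
  assumes "2 \<le> norm x" "0 < K"
  shows "cutoff K x = 1"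
proof -
  have "(norm x)\<^sup>2 \<ge> 2\<^sup>2" using assms(1) by (intro power_mono) auto
  then have "1 \<le> max 0 (x \<bullet> x - 1) ^ K" by (intro one_le_power) (simp add: dot_square_norm)
  then show ?thesis using assms(2) by (simp add: cutoff_def max_def)
qed

lemma dbound_one_minus:
  fixes f :: "'a::real_normed_vector \<Rightarrow> real"
  assumes "open S" "dbound e S L f (\<lambda>_. B)"
  shows "\<exists>C. dbound e S L (\<lambda>x. 1 - f x) (\<lambda>_. C)"
proof -
  have "dbound e S L (\<lambda>x. 1 + (-1) * f x) (\<lambda>_. 1 + 2 ^ L * 1 * B)"
    by (intro dbound_add dbound_mult dbound_const assms) auto
  then show ?thesis by auto
qed

lemma cutoff_dbound:
  fixes e :: "'a::real_inner"
  assumes "L < K"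
  shows "\<exists>C. dbound e (ball 0 3) L (cutoff K) (\<lambda>_. C)"
proof -
  let ?S = "ball (0::'a) 3"
  \<comment> \<open>One constant has to serve all orders: on the ball 6 |e| bounds the function, and
    2 |e|^2 is its constant derivative.\<close>
  have lin: "dbound e ?S L (\<lambda>x. x \<bullet> (2 *\<^sub>R e)) (\<lambda>_. 6 * norm e + 2 * (e \<bullet> e))" for L
  proof -
    have le: "\<bar>x \<bullet> (2 *\<^sub>R e)\<bar> \<le> 6 * norm e + 2 * (e \<bullet> e)" if "x \<in> ?S" for x
    proof -
      have "\<bar>x \<bullet> (2 *\<^sub>R e)\<bar> \<le> norm x * (2 * norm e)"
        using Cauchy_Schwarz_ineq2[of x "2 *\<^sub>R e"] by simp
      also have "\<dots> \<le> 3 * (2 * norm e)" using that by (intro mult_right_mono) auto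
      finally show ?thesis using inner_ge_zero[of e] by linarith
    qed
    show ?thesis
    proof (cases L)
      case (Suc k)
      show ?thesis unfolding Suc
      proof (rule dbound_Suc_cong)
        show "has_dirderiv e (\<lambda>x. x \<bullet> (2 *\<^sub>R e)) x (e \<bullet> (2 *\<^sub>R e))" for x
          unfolding has_dirderiv_def inner_add_left inner_scaleR_left
          by (rule derivative_eq_intros refl)+ simp_all
      qed (use le in \<open>auto intro!: dbound_const simp: add_nonneg_nonneg\<close>)
    qed (use le in auto)
  qed
  have sq: "\<bar>x \<bullet> x\<bar> \<le> 9 + 6 * norm e + 2 * (e \<bullet> e)" if "x \<in> ?S" for x
  proof -
    have "(norm x)\<^sup>2 \<le> 3\<^sup>2" using that by (intro power_mono) auto
    then have "x \<bullet> x \<le> 9" by (simp add: dot_square_norm)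
    moreover have "0 \<le> x \<bullet> x" "0 \<le> e \<bullet> e" by simp_all
    ultimately show ?thesis using norm_ge_zero[of e] by linarith
  qed
  have "dbound e ?S L (\<lambda>x. x \<bullet> x) (\<lambda>_. 9 + 6 * norm e + 2 * (e \<bullet> e))"
  proof (cases L)
    case (Suc k)
    show ?thesis unfolding Suc
    proof (rule dbound_Suc_cong)
      show "has_dirderiv e (\<lambda>x. x \<bullet> x) x (x \<bullet> (2 *\<^sub>R e))" for x
      proof -
        have "((\<lambda>s. x \<bullet> x + 2 * s * (x \<bullet> e) + s\<^sup>2 * (e \<bullet> e)) has_real_derivative x \<bullet> (2 *\<^sub>R e)) (at 0)"
          by (rule derivative_eq_intros refl)+ simp_all
        moreover have "(x + s *\<^sub>R e) \<bullet> (x + s *\<^sub>R e) = x \<bullet> x + 2 * s * (x \<bullet> e) + s\<^sup>2 * (e \<bullet> e)" for s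
          by (simp add: inner_add_left inner_add_right inner_commute power2_eq_square algebra_simps)
        ultimately show ?thesis
          by (simp add: has_dirderiv_def has_real_derivative_iff_has_vector_derivative)
      qed
      show "dbound e ?S k (\<lambda>x. x \<bullet> (2 *\<^sub>R e)) (\<lambda>_. 9 + 6 * norm e + 2 * (e \<bullet> e))"
        by (rule dbound_const_weight_mono[OF lin]) simp
    qed (use sq in auto)
  qed (use sq in auto)
  then have "dbound e ?S L (\<lambda>x. x \<bullet> x + (- 1)) (\<lambda>_. (9 + 6 * norm e + 2 * (e \<bullet> e)) + 1)"
    by (intro dbound_add dbound_const) auto
  then have "dbound e ?S L (\<lambda>x. x \<bullet> x - 1) (\<lambda>_. (9 + 6 * norm e + 2 * (e \<bullet> e)) + 1)"
    by simp
  then obtain C1 where "dbound e ?S L (\<lambda>x. max 0 (x \<bullet> x - 1) ^ K) (\<lambda>_. C1)"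
    using dbound_max_power[OF open_ball _ assms] by blast
  then obtain C2 where "dbound e ?S L (\<lambda>x. 1 - max 0 (x \<bullet> x - 1) ^ K) (\<lambda>_. C2)"
    using dbound_one_minus[OF open_ball] by blast
  then obtain C3 where "dbound e ?S L (\<lambda>x. max 0 (1 - max 0 (x \<bullet> x - 1) ^ K) ^ K) (\<lambda>_. C3)"
    using dbound_max_power[OF open_ball _ assms] by blast
  then show ?thesis
    unfolding cutoff_def[abs_def] by (rule dbound_one_minus[OF open_ball])
qed

section \<open>The phase with its singularity at the origin cut off\<close>

context homogeneous_phase
begin

text \<open>Higher derivatives have lower degree, but where 1/|x| \<le> 2 each lost power costs only
  a factor 2, so all orders fit under one majorant. The radius 1/2 makes the region overlap the unit
  ball, where the cutoff vanishes.\<close>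

lemma iter_partial_dbound:
  "\<exists>C\<ge>0. dbound (axis i 1) {x. 1 / 2 < norm x} L (iter_partial is \<mu>) (\<lambda>x. C * norm x powr (m - length is))"
proof (induction L arbitrary: "is")
  case 0
  obtain C where C: "0 \<le> C" "\<And>x. x \<noteq> 0 \<Longrightarrow> \<bar>iter_partial is \<mu> x\<bar> \<le> C * norm x powr (m - length is)"
    using iter_partial_bound[of "is"] by blast
  have "\<bar>iter_partial is \<mu> x\<bar> \<le> C * norm x powr (m - length is)" if "1 / 2 < norm x" for x
    using that by (intro C(2)) auto
  then show ?case using C(1) by (intro exI[of _ C]) auto
next
  case (Suc L)
  obtain C1 where C1: "0 \<le> C1" "\<And>x. x \<noteq> 0 \<Longrightarrow> \<bar>iter_partial is \<mu> x\<bar> \<le> C1 * norm x powr (m - length is)"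
    using iter_partial_bound[of "is"] by blast
  obtain C2 where C2: "0 \<le> C2" "dbound (axis i 1) {x. 1 / 2 < norm x} L (iter_partial (i # is) \<mu>)
      (\<lambda>x. C2 * norm x powr (m - length (i # is)))"
    using Suc by blast
  define C where "C = C1 + 2 * C2"
  have "dbound (axis i 1) {x. 1 / 2 < norm x} (Suc L) (iter_partial is \<mu>) (\<lambda>x. C * norm x powr (m - length is))"
  proof (rule dbound_Suc_cong)
    show "open {x::real^'n. 1 / 2 < norm x}" by (intro open_Collect_less continuous_intros)
    show "has_dirderiv (axis i 1) (iter_partial is \<mu>) x (iter_partial (i # is) \<mu> x)" if "x \<in> {x. 1 / 2 < norm x}" for x
      using that by (intro has_dirderiv_iter_partial[OF smooth]) auto
    show "norm (iter_partial is \<mu> x) \<le> C * norm x powr (m - length is)" if "x \<in> {x. 1 / 2 < norm x}" for x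
    proof -
      have "\<bar>iter_partial is \<mu> x\<bar> \<le> C1 * norm x powr (m - length is)"
        using that by (intro C1(2)) auto
      also have "\<dots> \<le> C * norm x powr (m - length is)"
        using C2(1) by (intro mult_right_mono) (auto simp: C_def)
      finally show ?thesis by simp
    qed
    show "dbound (axis i 1) {x. 1 / 2 < norm x} L (iter_partial (i # is) \<mu>) (\<lambda>x. C * norm x powr (m - length is))"
    proof (rule dbound_mono[OF C2(2)])
      fix x :: "real^'n" assume x: "x \<in> {x. 1 / 2 < norm x}"
      have eq: "norm x powr (m - length (i # is)) = norm x powr (m - length is) * inverse (norm x)"
      proof -
        have "m - length (i # is) = (m - length is) - 1" by simp
        moreover have "0 < norm x" using x by (auto intro: less_trans)
        ultimately show ?thesis by (simp only: powr_diff powr_one divide_inverse less_imp_le)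
      qed
      have "inverse (norm x) \<le> 2" using x le_imp_inverse_le[of "1/2" "norm x"] by simp
      then have "norm x powr (m - length is) * inverse (norm x) \<le> norm x powr (m - length is) * 2"
        by (intro mult_left_mono) auto
      then have "C2 * norm x powr (m - length (i # is)) \<le> C2 * (norm x powr (m - length is) * 2)"
        unfolding eq using C2(1) by (rule mult_left_mono)
      also have "\<dots> \<le> C * norm x powr (m - length is)"
        using C1(1) by (simp add: C_def distrib_right)
      finally show "C2 * norm x powr (m - length (i # is)) \<le> C * norm x powr (m - length is)" .
    qed simp
  qed
  moreover have "0 \<le> C" using C1(1) C2(1) by (simp add: C_def)
  ultimately show ?case by blast
qed

definition mut :: "nat \<Rightarrow> real^'n \<Rightarrow> real" where
  "mut K x = cutoff K x * \<mu> x"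

lemma mut_eq: "2 \<le> norm x \<Longrightarrow> 0 < K \<Longrightarrow> mut K x = \<mu> x"
  by (simp add: mut_def cutoff_eq_1)

text \<open>On the unit ball the product vanishes identically; on the overlapping shell 1/2 < |x| <
  3 both factors have bounded derivatives.\<close>

lemma mut_dbound_ball:
  assumes "L < K"
  shows "\<exists>C\<ge>0. dbound (axis i 1) (ball 0 3) L (mut K) (\<lambda>_. C)"
proof -
  let ?A = "{x::real^'n. 1 / 2 < norm x} \<inter> ball 0 3"
  have oA: "open ?A" by (intro open_Int open_Collect_less continuous_intros) auto
  obtain C1 where C1: "dbound (axis i 1) (ball 0 3) L (cutoff K :: real^'n \<Rightarrow> real) (\<lambda>_. C1)"
    using cutoff_dbound[OF assms] by blast
  obtain C2 where C2: "0 \<le> C2" "dbound (axis i 1) {x. 1 / 2 < norm x} L \<mu> (\<lambda>x. C2 * norm x powr m)"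
    using iter_partial_dbound[of i L "[]"] by auto
  have "dbound (axis i 1) ?A L \<mu> (\<lambda>_. C2 * 3 powr m)"
    using m_ge C2(1) by (intro dbound_mono[OF C2(2)] mult_left_mono powr_mono2) auto
  from dbound_mult[OF oA dbound_mono[OF C1] this]
  have 1: "dbound (axis i 1) ?A L (mut K) (\<lambda>_. 2 ^ L * C1 * (C2 * 3 powr m))"
    unfolding mut_def[abs_def] by simp
  define C where "C = max 0 (2 ^ L * C1 * (C2 * 3 powr m))"
  have "dbound (axis i 1) (ball 0 1) L (mut K) (\<lambda>_. C)"
  proof (rule dbound_cong[of _ "\<lambda>_. 0"])
    show "dbound (axis i 1) (ball 0 1) L (\<lambda>_. 0 :: real) (\<lambda>_. C)"
      by (rule dbound_const) (auto simp: C_def)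
  qed (use assms in \<open>auto simp: mut_def cutoff_eq_0\<close>)
  moreover have "dbound (axis i 1) ?A L (mut K) (\<lambda>_. C)"
    by (rule dbound_const_weight_mono[OF 1]) (simp add: C_def)
  ultimately have "dbound (axis i 1) (ball 0 1 \<union> ?A) L (mut K) (\<lambda>_. C)" by (rule dbound_Un)
  moreover have "ball 0 3 \<subseteq> ball 0 1 \<union> ?A" by auto
  ultimately have "dbound (axis i 1) (ball 0 3) L (mut K) (\<lambda>_. C)"
    by (auto intro: dbound_mono)
  then show ?thesis by (intro exI[of _ C]) (simp add: C_def)
qed

lemma measurable_mu: "\<mu> \<in> borel_measurable borel"
proof -
  have "(\<lambda>x. if x \<in> - {0} then \<mu> x else \<mu> 0) \<in> borel_measurable borel"
    using continuous_iter_partial[of "[]"]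
    by (intro borel_measurable_continuous_on_if) auto
  moreover have "(\<lambda>x. if x \<in> - {0} then \<mu> x else \<mu> 0) = \<mu>" by auto
  ultimately show ?thesis by simp
qed

lemma measurable_mut: "mut K \<in> borel_measurable borel"
proof -
  have [measurable]: "\<mu> \<in> borel_measurable borel" by (rule measurable_mu)
  show ?thesis unfolding mut_def[abs_def] cutoff_def by measurable
qed

text \<open>The region |x| > 2, where the cutoff is 1, and the ball of radius 3 form an open cover
  on which the bounds are glued. The first derivative is kept apart because only it is affected by
  subtracting the linear part of the phase; orders 2 to L + 2 share the growth m - 2, hence L + 2 <
  K.\<close>

lemma mut_derivatives:
  fixes i :: 'n
  assumes "Suc (Suc L) < K"
  defines "e \<equiv> axis i 1 :: real^'n"
  shows "has_dirderiv e (mut K) x (dirderiv e (mut K) x)"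
    and "has_dirderiv e (dirderiv e (mut K)) x (dirderiv e (dirderiv e (mut K)) x)"
    and "2 < norm x \<Longrightarrow> dirderiv e (mut K) x = iter_partial [i] \<mu> x"
    and "\<exists>C\<ge>0. (\<forall>x. \<bar>dirderiv e (mut K) x\<bar> \<le> C * (1 + norm x) powr (m - 1)) \<and>
      dbound e UNIV L (dirderiv e (dirderiv e (mut K))) (\<lambda>x. C * (1 + norm x) powr (m - 2))"
proof -
  define T where "T = {x::real^'n. 2 < norm x}"
  have oT: "open T" unfolding T_def by (intro open_Collect_less continuous_intros)
  have cases: "x \<in> T \<or> x \<in> ball 0 3" for x by (auto simp: T_def)
  obtain C1 where C1: "0 \<le> C1" "dbound e (ball 0 3) (Suc (Suc L)) (mut K) (\<lambda>_. C1)"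
    using mut_dbound_ball[OF assms(1), of i] by (auto simp: e_def)
  have mutT: "mut K x = \<mu> x" if "x \<in> T" for x
    using that assms(1) by (intro mut_eq) (auto simp: T_def)
  have T0: "x \<noteq> 0" if "x \<in> T" for x using that by (auto simp: T_def)
  have d0: "has_dirderiv e (mut K) x (iter_partial [i] \<mu> x)" if x: "x \<in> T" for x
  proof -
    have "has_dirderiv e \<mu> x (iter_partial [i] \<mu> x)"
      using has_dirderiv_iter_partial[OF smooth, of x i "[]"] T0[OF x] by (simp add: e_def)
    then show ?thesis
      using has_dirderiv_cong[OF oT x, of \<mu> "mut K"] mutT by auto
  qed
  have d1: "dirderiv e (mut K) x = iter_partial [i] \<mu> x" if "x \<in> T" for x
    using dirderiv_eqI[OF d0[OF that]] .
  then show "2 < norm x \<Longrightarrow> dirderiv e (mut K) x = iter_partial [i] \<mu> x"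
    by (simp add: T_def)
  have d2: "has_dirderiv e (dirderiv e (mut K)) x (iter_partial [i, i] \<mu> x)" if x: "x \<in> T" for x
  proof -
    have "has_dirderiv e (iter_partial [i] \<mu>) x (iter_partial [i, i] \<mu> x)"
      using has_dirderiv_iter_partial[OF smooth, of x i "[i]"] T0[OF x] by (simp add: e_def)
    then show ?thesis
      using has_dirderiv_cong[OF oT x, of "iter_partial [i] \<mu>" "dirderiv e (mut K)"] d1 by auto
  qed
  have d3: "dirderiv e (dirderiv e (mut K)) x = iter_partial [i, i] \<mu> x" if "x \<in> T" for x
    using dirderiv_eqI[OF d2[OF that]] .
  show "has_dirderiv e (mut K) x (dirderiv e (mut K) x)"
    using cases[of x] C1(2) d0[of x] d1[of x] by auto
  show "has_dirderiv e (dirderiv e (mut K)) x (dirderiv e (dirderiv e (mut K)) x)"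
    using cases[of x] C1(2) d2[of x] d3[of x] by auto
  obtain C2 where C2: "0 \<le> C2" "\<And>x. x \<noteq> 0 \<Longrightarrow> \<bar>iter_partial [i] \<mu> x\<bar> \<le> C2 * norm x powr (m - length [i])"
    using iter_partial_bound[of "[i]"] by blast
  obtain C3 where C3: "0 \<le> C3" "dbound e {x. 1 / 2 < norm x} L (iter_partial [i, i] \<mu>) (\<lambda>x. C3 * norm x powr (m - length [i, i]))"
    using iter_partial_dbound[of i L "[i, i]"] unfolding e_def by blast
  define C where "C = C1 + C2 + C3"
  have C: "0 \<le> C" "C1 \<le> C" "C2 \<le> C" "C3 \<le> C" using C1 C2 C3 by (auto simp: C_def)
  \<comment> \<open>Since m \<ge> 2, these growth factors are at least 1 and dominate the constant
    bound valid on the ball.\<close>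
  have one_le: "1 \<le> (1 + norm x) powr (m - q)" if "q \<le> 2" for x :: "real^'n" and q
    using that m_ge by (intro ge_one_powr_ge_zero) auto
  have b1: "\<bar>dirderiv e (mut K) x\<bar> \<le> C * (1 + norm x) powr (m - 1)" for x
    using cases[of x]
  proof
    assume x: "x \<in> T"
    have "\<bar>dirderiv e (mut K) x\<bar> \<le> C2 * norm x powr (m - 1)"
      using C2(2)[OF T0[OF x]] d1[OF x] by simp
    also have "\<dots> \<le> C * (1 + norm x) powr (m - 1)"
      using C C2(1) m_ge by (intro mult_mono powr_mono2) auto
    finally show ?thesis .
  next
    assume x: "x \<in> ball 0 3"
    have "\<bar>dirderiv e (mut K) x\<bar> \<le> C1"
      using C1(2) x by simp
    also have "\<dots> \<le> C * (1 + norm x) powr (m - 1)"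
      using mult_mono[OF C(2) one_le[of 1 x]] C(1) by simp
    finally show ?thesis .
  qed
  have "dbound e T L (iter_partial [i, i] \<mu>) (\<lambda>x. C * (1 + norm x) powr (m - 2))"
    by (rule dbound_mono[OF C3(2)]) (use C C3(1) m_ge in \<open>auto simp: T_def intro!: mult_mono powr_mono2\<close>)
  then have "dbound e T L (dirderiv e (dirderiv e (mut K))) (\<lambda>x. C * (1 + norm x) powr (m - 2))"
    by (rule dbound_cong[OF oT, rotated]) (simp add: d3)
  moreover have "dbound e (ball 0 3) L (dirderiv e (dirderiv e (mut K))) (\<lambda>x. C * (1 + norm x) powr (m - 2))"
  proof (rule dbound_mono)
    show "dbound e (ball 0 3) L (dirderiv e (dirderiv e (mut K))) (\<lambda>_. C1)" using C1(2) by simp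
    show "C1 \<le> C * (1 + norm x) powr (m - 2)" for x :: "real^'n"
      using mult_mono[OF C(2) one_le[of 2 x]] C(1) by simp
  qed simp
  ultimately have "dbound e (T \<union> ball 0 3) L (dirderiv e (dirderiv e (mut K))) (\<lambda>x. C * (1 + norm x) powr (m - 2))"
    by (rule dbound_Un)
  moreover have "T \<union> ball 0 3 = UNIV" by (auto simp: T_def)
  ultimately show "\<exists>C\<ge>0. (\<forall>x. \<bar>dirderiv e (mut K) x\<bar> \<le> C * (1 + norm x) powr (m - 1)) \<and>
      dbound e UNIV L (dirderiv e (dirderiv e (mut K))) (\<lambda>x. C * (1 + norm x) powr (m - 2))"
    using b1 C(1) by auto
qed

end

section \<open>Decay away from the gradient\<close>

context homogeneous_phase
begin

text \<open>Trades a real exponent for a natural one, the form in which the decay of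
  \<open>rapid\<close> functions is available.\<close>

lemma one_plus_powr_le_power:
  assumes "a \<le> m" "0 \<le> a"
  shows "(1 + norm (t::real^'n)) powr a \<le> (1 + norm t) ^ nat \<lceil>m\<rceil>"
proof -
  have "(1 + norm t) powr a \<le> (1 + norm t) powr real (nat \<lceil>m\<rceil>)"
  proof (rule powr_mono)
    show "a \<le> real (nat \<lceil>m\<rceil>)" using assms m_ge by linarith
  qed simp
  also have "\<dots> = (1 + norm t) ^ nat \<lceil>m\<rceil>"
    by (intro powr_realpow) (simp add: add_pos_nonneg)
  finally show ?thesis .
qed

text \<open>The mean value theorem along the segment: |t| \<le> |z| / 2 keeps it away from the
  origin and within radius 2 |z|, so second derivatives are O(|z|^(m-2)) on it.\<close>

lemma iter_partial_increment_le:
  obtains C where "0 \<le> C"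
    "\<And>z t. 4 < norm z \<Longrightarrow> norm t \<le> norm z / 2 \<Longrightarrow>
       \<bar>iter_partial [i] \<mu> (z + t) - iter_partial [i] \<mu> z\<bar> \<le> C * norm z powr (m - 2) * norm t"
proof -
  have "\<exists>c. \<forall>k. 0 \<le> c k \<and> (\<forall>x. x \<noteq> 0 \<longrightarrow> \<bar>iter_partial [k, i] \<mu> x\<bar> \<le> c k * norm x powr (m - 2))"
  proof (intro choice allI)
    fix k
    obtain C where "0 \<le> C" "\<And>x. x \<noteq> 0 \<Longrightarrow> \<bar>iter_partial [k, i] \<mu> x\<bar> \<le> C * norm x powr (m - length [k, i])"
      using iter_partial_bound[of "[k, i]"] by blast
    then show "\<exists>C. 0 \<le> C \<and> (\<forall>x. x \<noteq> 0 \<longrightarrow> \<bar>iter_partial [k, i] \<mu> x\<bar> \<le> C * norm x powr (m - 2))"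
      by (intro exI[of _ C]) simp
  qed
  then obtain c where c: "\<And>k. 0 \<le> c k" "\<And>k x. x \<noteq> 0 \<Longrightarrow> \<bar>iter_partial [k, i] \<mu> x\<bar> \<le> c k * norm x powr (m - 2)"
    by blast
  define C where "C = (\<Sum>k\<in>UNIV. c k) * 2 powr (m - 2)"
  show thesis
  proof
    show "0 \<le> C" unfolding C_def using c(1) by (intro mult_nonneg_nonneg sum_nonneg) auto
    fix z t :: "real^'n" assume z: "4 < norm z" and t: "norm t \<le> norm z / 2"
    define \<phi>' where "\<phi>' s = (\<Sum>k\<in>UNIV. t $ k * iter_partial [k, i] \<mu> (z + s *\<^sub>R t))" for s
    have st: "norm (s *\<^sub>R t) \<le> norm z / 2" if "0 \<le> s" "s \<le> 1" for s
    proof -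
      have "norm (s *\<^sub>R t) \<le> 1 * norm t"
        using that by (simp add: mult_left_le_one_le)
      then show ?thesis using t by simp
    qed
    have nz: "z + s *\<^sub>R t \<noteq> 0" if "0 \<le> s" "s \<le> 1" for s
    proof
      assume "z + s *\<^sub>R t = 0"
      then have "norm z = norm (s *\<^sub>R t)" by (metis add_eq_0_iff norm_minus_cancel)
      then show False using st[OF that] z by linarith
    qed
    have der: "((\<lambda>s. iter_partial [i] \<mu> (z + s *\<^sub>R t)) has_real_derivative \<phi>' s) (at s)" if "0 \<le> s" "s \<le> 1" for s
      using has_dirderiv_along[OF has_dirderiv_iter_partial_any[OF nz[OF that], of t "[i]"]]
      by (simp add: has_real_derivative_iff_has_vector_derivative \<phi>'_def)
    have "\<exists>s. 0 < s \<and> s < 1 \<and> iter_partial [i] \<mu> (z + 1 *\<^sub>R t) - iter_partial [i] \<mu> (z + 0 *\<^sub>R t) = (1 - 0) * \<phi>' s"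
      by (rule MVT2) (use der in auto)
    then obtain s where s: "0 < s" "s < 1" "iter_partial [i] \<mu> (z + t) - iter_partial [i] \<mu> z = \<phi>' s"
      by auto
    define N where "N = norm (z + s *\<^sub>R t) powr (m - 2)"
    have "norm (z + s *\<^sub>R t) \<le> 2 * norm z"
      using norm_triangle_ineq[of z "s *\<^sub>R t"] st[of s] s norm_ge_zero[of z] by linarith
    then have N: "N \<le> 2 powr (m - 2) * norm z powr (m - 2)"
      unfolding N_def powr_mult[symmetric] using m_ge by (intro powr_mono2) auto
    have "\<bar>\<phi>' s\<bar> \<le> (\<Sum>k\<in>UNIV. \<bar>t $ k * iter_partial [k, i] \<mu> (z + s *\<^sub>R t)\<bar>)"
      unfolding \<phi>'_def by (rule sum_abs)
    also have "\<dots> \<le> (\<Sum>k\<in>UNIV. norm t * (c k * N))"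
    proof (rule sum_mono)
      fix k
      have "\<bar>iter_partial [k, i] \<mu> (z + s *\<^sub>R t)\<bar> \<le> c k * N"
        unfolding N_def using s by (intro c(2) nz) auto
      then show "\<bar>t $ k * iter_partial [k, i] \<mu> (z + s *\<^sub>R t)\<bar> \<le> norm t * (c k * N)"
        unfolding abs_mult by (intro mult_mono component_le_norm_cart) auto
    qed
    also have "\<dots> = (\<Sum>k\<in>UNIV. c k) * norm t * N"
      by (simp add: sum_distrib_left sum_distrib_right mult_ac)
    also have "\<dots> \<le> (\<Sum>k\<in>UNIV. c k) * norm t * (2 powr (m - 2) * norm z powr (m - 2))"
      using N c(1) by (intro mult_left_mono mult_nonneg_nonneg sum_nonneg) auto
    also have "\<dots> = C * norm z powr (m - 2) * norm t"
      by (simp add: C_def mult_ac)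
    finally show "\<bar>iter_partial [i] \<mu> (z + t) - iter_partial [i] \<mu> z\<bar> \<le> C * norm z powr (m - 2) * norm t"
      using s(3) by simp
  qed
qed

lemma phase_increment_le:
  fixes i :: 'n
  assumes K: "2 < K"
  obtains C where "0 \<le> C"
    "\<And>z t. 4 < norm z \<Longrightarrow> \<bar>dirderiv (axis i 1) (mut K) (z + t) - grad z $ i\<bar>
       \<le> C * norm z powr (m - 2) * (1 + norm t) ^ nat \<lceil>m\<rceil>"
proof -
  define e where "e = (axis i 1 :: real^'n)"
  obtain C1 where C1: "0 \<le> C1" "\<And>z t. 4 < norm z \<Longrightarrow> norm t \<le> norm z / 2 \<Longrightarrow>
       \<bar>iter_partial [i] \<mu> (z + t) - iter_partial [i] \<mu> z\<bar> \<le> C1 * norm z powr (m - 2) * norm t"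
    using iter_partial_increment_le[of i] by blast
  obtain C2 where C2: "0 \<le> C2" "\<And>x. \<bar>dirderiv e (mut K) x\<bar> \<le> C2 * (1 + norm x) powr (m - 1)"
    using mut_derivatives(4)[of 0 K i] K unfolding e_def by auto
  obtain C3 where C3: "0 \<le> C3" "\<And>x. x \<noteq> 0 \<Longrightarrow> \<bar>iter_partial [i] \<mu> x\<bar> \<le> C3 * norm x powr (m - length [i])"
    using iter_partial_bound[of "[i]"] by blast
  define C where "C = C1 + (C2 + C3) * 3 powr (m - 1)"
  have C: "C1 \<le> C" "(C2 + C3) * 3 powr (m - 1) \<le> C" "0 \<le> C"
    using C1(1) C2(1) C3(1) by (auto simp: C_def add_nonneg_nonneg)
  have grad: "grad z $ i = iter_partial [i] \<mu> z" for z by (simp add: grad_def)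
  show thesis
  proof
    show "0 \<le> C" by (rule C)
    fix z t :: "real^'n" assume z: "4 < norm z"
    have z0: "z \<noteq> 0" using z by auto
    define R where "R = norm z powr (m - 2)"
    define T where "T = (1 + norm t) ^ nat \<lceil>m\<rceil>"
    have R: "1 \<le> R" using z m_ge by (simp add: R_def ge_one_powr_ge_zero)
    have T: "0 \<le> T" by (simp add: T_def)
    have "\<bar>dirderiv e (mut K) (z + t) - grad z $ i\<bar> \<le> C * R * T"
    proof (cases "norm t \<le> norm z / 2")
      case True
      \<comment> \<open>The threshold 4 acts here: z + t stays outside radius 2, where the cut-off
        phase coincides with \<mu>.\<close>
      have "norm z \<le> norm (z + t) + norm t" using norm_triangle_ineq4[of "z + t" t] by simp
      then have "2 < norm (z + t)" using True z by linarith
      then have "dirderiv e (mut K) (z + t) = iter_partial [i] \<mu> (z + t)"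
        unfolding e_def using K by (intro mut_derivatives(3)[of 0]) auto
      then have "\<bar>dirderiv e (mut K) (z + t) - grad z $ i\<bar> \<le> C1 * R * norm t"
        using C1(2)[OF z True] by (simp add: grad R_def)
      also have "\<dots> \<le> C * R * T"
      proof (intro mult_mono)
        have "norm t \<le> (1 + norm t) powr 1" by simp
        also have "\<dots> \<le> T" unfolding T_def using m_ge by (intro one_plus_powr_le_power) auto
        finally show "norm t \<le> T" .
      qed (use C R in auto)
      finally show ?thesis .
    next
      case False
      have T': "(3 * (1 + norm t)) powr (m - 1) \<le> 3 powr (m - 1) * T"
        unfolding T_def powr_mult using m_ge
        by (intro mult_left_mono one_plus_powr_le_power) auto
      have "1 + norm (z + t) \<le> 1 + (norm z + norm t)"
        by (simp add: norm_triangle_ineq)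
      also have "\<dots> \<le> 3 * (1 + norm t)"
        using False norm_ge_zero[of t] unfolding not_le distrib_left by linarith
      finally have "(1 + norm (z + t)) powr (m - 1) \<le> (3 * (1 + norm t)) powr (m - 1)"
        using m_ge by (intro powr_mono2) auto
      then have 1: "\<bar>dirderiv e (mut K) (z + t)\<bar> \<le> C2 * (3 powr (m - 1) * T)"
        using C2(1) T' by (intro order_trans[OF C2(2)] mult_left_mono) auto
      have "norm z \<le> 3 * (1 + norm t)"
        using False norm_ge_zero[of t] unfolding not_le distrib_left by linarith
      then have "norm z powr (m - 1) \<le> (3 * (1 + norm t)) powr (m - 1)"
        using m_ge by (intro powr_mono2) auto
      then have "C3 * norm z powr (m - 1) \<le> C3 * (3 powr (m - 1) * T)"
        using C3(1) T' by (intro mult_left_mono) auto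
      moreover have "\<bar>grad z $ i\<bar> \<le> C3 * norm z powr (m - 1)"
        unfolding grad using C3(2)[OF z0] by simp
      ultimately have "\<bar>dirderiv e (mut K) (z + t) - grad z $ i\<bar> \<le> ((C2 + C3) * 3 powr (m - 1)) * T"
        using 1 by (simp add: algebra_simps)
      also have "\<dots> \<le> C * R * T"
      proof (intro mult_right_mono T)
        have "C * 1 \<le> C * R" using C(3) R by (intro mult_left_mono)
        then show "(C2 + C3) * 3 powr (m - 1) \<le> C * R" using C(2) by linarith
      qed
      finally show ?thesis .
    qed
    then show "\<bar>dirderiv (axis i 1) (mut K) (z + t) - grad z $ i\<bar>
       \<le> C * norm z powr (m - 2) * (1 + norm t) ^ nat \<lceil>m\<rceil>"
      by (simp add: e_def R_def T_def)
  qed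
qed

text \<open>The linear term is removed here and later joins y in the frequency. The constant term at
  z is kept, since it contributes only a unimodular factor.\<close>

definition phase :: "nat \<Rightarrow> real^'n \<Rightarrow> real^'n \<Rightarrow> complex" where
  "phase K z t = 2 * pi * \<i> * complex_of_real (mut K (z + t) - t \<bullet> grad z)"

lemma has_dirderiv_phase:
  assumes "2 < K"
  shows "has_dirderiv (axis i 1) (phase K z) t
    (2 * pi * \<i> * complex_of_real (dirderiv (axis i 1) (mut K) (z + t) - grad z $ i))"
proof -
  let ?e = "axis i 1 :: real^'n"
  have "has_dirderiv ?e (mut K) (z + t) (dirderiv ?e (mut K) (z + t))"
    using assms by (intro mut_derivatives(1)[of 0]) auto
  then have 1: "((\<lambda>s. mut K (z + (t + s *\<^sub>R ?e))) has_real_derivative dirderiv ?e (mut K) (z + t)) (at 0)"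
    by (simp add: has_dirderiv_def has_real_derivative_iff_has_vector_derivative add.assoc)
  have 2: "((\<lambda>s. (t + s *\<^sub>R ?e) \<bullet> grad z) has_real_derivative grad z $ i) (at 0)"
    unfolding inner_add_left inner_scaleR_left
    by (rule derivative_eq_intros refl)+ (simp_all add: inner_axis')
  have "((\<lambda>s. complex_of_real (mut K (z + (t + s *\<^sub>R ?e)) - (t + s *\<^sub>R ?e) \<bullet> grad z)) has_vector_derivative
      complex_of_real (dirderiv ?e (mut K) (z + t) - grad z $ i)) (at 0)"
    by (rule has_vector_derivative_of_real[OF DERIV_diff[OF 1 2]])
  then show ?thesis
    unfolding has_dirderiv_def phase_def by (rule has_vector_derivative_mult_right)
qed

lemma phase_dbound:
  fixes i :: 'n
  assumes K: "Suc (Suc L) < K"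
  obtains P where "1 \<le> P"
    "\<And>z. 4 < norm z \<Longrightarrow> dbound (axis i 1) UNIV L (dirderiv (axis i 1) (phase K z))
       (\<lambda>t. P * norm z powr (m - 2) * (1 + norm t) ^ nat \<lceil>m\<rceil>)"
proof -
  define e where "e = (axis i 1 :: real^'n)"
  obtain C1 where C1: "0 \<le> C1" "\<And>z t. 4 < norm z \<Longrightarrow> \<bar>dirderiv e (mut K) (z + t) - grad z $ i\<bar>
       \<le> C1 * norm z powr (m - 2) * (1 + norm t) ^ nat \<lceil>m\<rceil>"
    using phase_increment_le[of K i] K unfolding e_def by auto
  obtain C2 where C2: "0 \<le> C2" "dbound e UNIV L (dirderiv e (dirderiv e (mut K))) (\<lambda>x. C2 * (1 + norm x) powr (m - 2))"
    using mut_derivatives(4)[OF K, of i] unfolding e_def by auto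
  define C where "C = C1 + C2 * 2 powr (m - 2)"
  have C: "C1 \<le> C" "C2 * 2 powr (m - 2) \<le> C" "0 \<le> C" using C1(1) C2(1) by (auto simp: C_def)
  \<comment> \<open>The maximum with 1 meets the requirement on the majorant in
    \<open>dbound_exp_mult\<close>.\<close>
  define P where "P = max 1 (2 ^ L * (2 * pi) * C)"
  show thesis
  proof
    show "1 \<le> P" by (simp add: P_def)
    fix z :: "real^'n" assume z: "4 < norm z"
    define R where "R = norm z powr (m - 2)"
    define T where "T t = (1 + norm t) ^ nat \<lceil>m\<rceil>" for t :: "real^'n"
    have R: "1 \<le> R" using z m_ge by (simp add: R_def ge_one_powr_ge_zero)
    have T: "0 \<le> T t" for t by (simp add: T_def)
    define q where "q t = dirderiv e (mut K) (z + t) - grad z $ i" for t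
    have "dbound e UNIV (Suc L) q (\<lambda>t. C * R * T t)"
    proof (rule dbound_Suc_cong)
      show "has_dirderiv e q t (dirderiv e (dirderiv e (mut K)) (z + t))" for t
        using mut_derivatives(2)[OF K, of i "z + t"]
        by (simp add: has_dirderiv_def q_def e_def has_vector_derivative_diff_const add.assoc)
      show "norm (q t) \<le> C * R * T t" for t
      proof -
        have "norm (q t) \<le> C1 * R * T t"
          using C1(2)[OF z, of t] by (simp add: q_def R_def T_def)
        also have "\<dots> \<le> C * R * T t"
          using C R T by (intro mult_right_mono) auto
        finally show ?thesis .
      qed
      show "dbound e UNIV L (\<lambda>t. dirderiv e (dirderiv e (mut K)) (z + t)) (\<lambda>t. C * R * T t)"
      proof (rule dbound_mono[OF dbound_translate[OF C2(2)]])
        fix t :: "real^'n"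
        \<comment> \<open>Submultiplicativity of 1 + |.| splits the growth at z + t into |z|^(m-2)
          and a polynomial weight in t.\<close>
        have "1 + norm z \<le> 2 * norm z" using z by simp
        then have "1 + norm (z + t) \<le> (2 * norm z) * (1 + norm t)"
          by (intro order_trans[OF one_plus_norm_add_le] mult_right_mono) auto
        then have "(1 + norm (z + t)) powr (m - 2) \<le> ((2 * norm z) * (1 + norm t)) powr (m - 2)"
          using m_ge by (intro powr_mono2) auto
        also have "\<dots> = 2 powr (m - 2) * R * (1 + norm t) powr (m - 2)"
          by (simp add: R_def powr_mult)
        also have "\<dots> \<le> 2 powr (m - 2) * R * T t"
          unfolding T_def using m_ge R by (intro mult_left_mono one_plus_powr_le_power) auto
        finally have "C2 * (1 + norm (z + t)) powr (m - 2) \<le> C2 * (2 powr (m - 2) * R * T t)"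
          using C2(1) by (rule mult_left_mono)
        also have "\<dots> = (C2 * 2 powr (m - 2)) * (R * T t)" by simp
        also have "\<dots> \<le> C * (R * T t)"
          using C R T by (intro mult_right_mono mult_nonneg_nonneg) auto
        finally show "C2 * (1 + norm (z + t)) powr (m - 2) \<le> C * R * T t" by (simp add: mult.assoc)
      qed simp
    qed simp
    then have "dbound e UNIV L q (\<lambda>t. C * R * T t)" by (rule dbound_le) simp
    then have "dbound e UNIV L (\<lambda>t. (2 * pi * \<i>) * complex_of_real (q t)) (\<lambda>t. 2 ^ L * (2 * pi) * (C * R * T t))"
      by (intro dbound_mult dbound_of_real dbound_const) (auto simp: norm_mult)
    moreover have "2 * pi * \<i> * complex_of_real (q t) = dirderiv e (phase K z) t" for t
      using dirderiv_eqI[OF has_dirderiv_phase[of K i z t]] K by (simp add: q_def e_def)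
    ultimately have "dbound e UNIV L (dirderiv e (phase K z)) (\<lambda>t. 2 ^ L * (2 * pi) * (C * R * T t))"
      by simp
    then show "dbound (axis i 1) UNIV L (dirderiv (axis i 1) (phase K z))
       (\<lambda>t. P * norm z powr (m - 2) * (1 + norm t) ^ nat \<lceil>m\<rceil>)"
      unfolding e_def
    proof (rule dbound_mono)
      fix t :: "real^'n"
      have "(2 ^ L * (2 * pi) * C) * (R * T t) \<le> P * (R * T t)"
        using R T by (intro mult_right_mono mult_nonneg_nonneg) (auto simp: P_def)
      then show "2 ^ L * (2 * pi) * (C * R * T t) \<le> P * norm z powr (m - 2) * (1 + norm t) ^ nat \<lceil>m\<rceil>"
        by (simp add: R_def T_def mult.assoc)
    qed simp
  qed
qed

lemma phase_fourier_component:
  fixes i :: 'n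
  assumes K: "Suc (Suc L) < K" and G: "rapid G"
  obtains C where "0 \<le> C" "\<And>z A. 4 < norm z \<Longrightarrow>
    \<bar>A $ i\<bar> ^ L * norm (ifourier (\<lambda>t. exp (phase K z t) * G t) A) \<le> C * (norm z powr (m - 2)) ^ L"
proof -
  define e where "e = (axis i 1 :: real^'n)"
  define W where "W = (LINT x|lborel. 1 / (1 + norm (x::real^'n)) ^ (2 * CARD('n)))"
  have W0: "0 \<le> W" unfolding W_def by (intro integral_nonneg_AE) auto
  define M where "M = nat \<lceil>m\<rceil>"
  obtain P where P: "1 \<le> P" "\<And>z. 4 < norm z \<Longrightarrow> dbound e UNIV L (dirderiv e (phase K z))
       (\<lambda>t. P * norm z powr (m - 2) * (1 + norm t) ^ M)"
    using phase_dbound[OF K, of i] unfolding e_def M_def by blast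
  \<comment> \<open>Differentiating the exponential L times costs (1 + |t|)^(M L); the remaining 2d
    powers of decay make the result integrable.\<close>
  obtain C1 where C1: "dbound e UNIV L G (\<lambda>x. C1 / (1 + norm x) ^ (M * L + 2 * CARD('n)))"
    using G unfolding rapid_def e_def by blast
  have C10: "0 \<le> C1" using order_trans[OF norm_ge_zero dbound_norm[OF C1, of 0]] by simp
  define C where "C = (2 ^ Suc L * P) ^ L * C1 * W"
  show thesis
  proof
    show "0 \<le> C" using P C10 W0 by (simp add: C_def)
    fix z A :: "real^'n" assume z: "4 < norm z"
    define R where "R = norm z powr (m - 2)"
    have R: "1 \<le> R" using z m_ge by (simp add: R_def ge_one_powr_ge_zero)
    have meas: "(\<lambda>t. exp (phase K z t) * G t) \<in> borel_measurable borel"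
    proof -
      have [measurable]: "mut K \<in> borel_measurable borel" "G \<in> borel_measurable borel"
        using measurable_mut rapid_measurable[OF G] by auto
      show ?thesis unfolding phase_def by measurable
    qed
    have one_le: "1 \<le> 1 + norm t" for t :: "real^'n" by simp
    have "dbound e UNIV L (\<lambda>t. exp (phase K z t) * G t)
        (\<lambda>t. (2 ^ Suc L * (P * R * (1 + norm t) ^ M)) ^ L * (C1 / (1 + norm t) ^ (M * L + 2 * CARD('n))))"
    proof (rule dbound_exp_mult[OF open_UNIV])
      show "norm (exp (phase K z t)) = 1" for t unfolding phase_def by (rule norm_character)
      show "has_dirderiv e (phase K z) t (dirderiv e (phase K z) t)" for t
        using has_dirderiv_phase[of K i z t] dirderiv_eqI[OF has_dirderiv_phase[of K i z t]] K
        by (simp add: e_def)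
      show "dbound e UNIV L (dirderiv e (phase K z)) (\<lambda>t. P * R * (1 + norm t) ^ M)"
        unfolding R_def by (rule P(2)[OF z])
      show "1 \<le> P * R * (1 + norm t) ^ M" for t :: "real^'n"
      proof -
        have "1 * 1 * 1 \<le> P * R * (1 + norm t) ^ M"
          using P R by (intro mult_mono one_le_power one_le) auto
        then show ?thesis by simp
      qed
    qed (use C1 in auto)
    moreover have "(2 ^ Suc L * (P * R * (1 + norm t) ^ M)) ^ L * (C1 / (1 + norm t) ^ (M * L + 2 * CARD('n)))
       = ((2 ^ Suc L * P) ^ L * C1 * R ^ L) / (1 + norm t) ^ (2 * CARD('n))" for t :: "real^'n"
    proof -
      have "0 < (1 + norm t)" by (simp add: add_pos_nonneg)
      then show ?thesis
        by (simp add: power_mult_distrib power_add power_mult[symmetric] field_simps del: power_Suc)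
    qed
    ultimately have "dbound e UNIV L (\<lambda>t. exp (phase K z t) * G t)
        (\<lambda>t. ((2 ^ Suc L * P) ^ L * C1 * R ^ L) / (1 + norm t) ^ (2 * CARD('n)))"
      by (simp only:)
    then have le: "(2 * pi * \<bar>e \<bullet> A\<bar>) ^ L * norm (ifourier (\<lambda>t. exp (phase K z t) * G t) A)
        \<le> ((2 ^ Suc L * P) ^ L * C1 * R ^ L) * W"
      unfolding W_def by (intro ifourier_dbound meas) (auto simp: e_def)
    have "\<bar>A $ i\<bar> ^ L \<le> (2 * pi * \<bar>e \<bullet> A\<bar>) ^ L"
      using pi_ge_two by (intro power_mono) (auto simp: e_def inner_axis' mult_le_cancel_right1)
    then have "\<bar>A $ i\<bar> ^ L * norm (ifourier (\<lambda>t. exp (phase K z t) * G t) A)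
        \<le> (2 * pi * \<bar>e \<bullet> A\<bar>) ^ L * norm (ifourier (\<lambda>t. exp (phase K z t) * G t) A)"
      by (rule mult_right_mono) simp
    also note le
    also have "((2 ^ Suc L * P) ^ L * C1 * R ^ L) * W = C * R ^ L" by (simp add: C_def)
    finally show "\<bar>A $ i\<bar> ^ L * norm (ifourier (\<lambda>t. exp (phase K z t) * G t) A) \<le> C * (norm z powr (m - 2)) ^ L"
      by (simp add: R_def)
  qed
qed

lemma phase_fourier_decay:
  assumes K: "Suc (Suc L) < K" and G: "rapid G"
  obtains C where "\<And>z A. 4 < norm z \<Longrightarrow>
    (1 + norm A / norm z powr (m - 2)) ^ L * norm (ifourier (\<lambda>t. exp (phase K z t) * G t) A) \<le> C"
proof -
  have "\<exists>c. \<forall>i::'n. 0 \<le> c i \<and> (\<forall>z A. 4 < norm z \<longrightarrow>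
    \<bar>A $ i\<bar> ^ L * norm (ifourier (\<lambda>t. exp (phase K z t) * G t) A) \<le> c i * (norm z powr (m - 2)) ^ L)"
    by (intro choice allI) (rule phase_fourier_component[OF K G], blast)
  then obtain c where c: "\<And>i. 0 \<le> c i" "\<And>i z A. 4 < norm z \<Longrightarrow>
    \<bar>A $ i\<bar> ^ L * norm (ifourier (\<lambda>t. exp (phase K z t) * G t) A) \<le> c i * (norm z powr (m - 2)) ^ L"
    by blast
  \<comment> \<open>With exponent 0 the component drops out, so any index serves; this is the plain
    bound needed where all components of the rescaled frequency are small.\<close>
  obtain C0 where C0: "0 \<le> C0" "\<And>z A. 4 < norm z \<Longrightarrow> norm (ifourier (\<lambda>t. exp (phase K z t) * G t) A) \<le> C0"
    using phase_fourier_component[of 0 K G undefined] K G by auto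
  define C where "C = C0 + (\<Sum>i\<in>UNIV. c i)"
  have C: "C0 \<le> C" "\<And>i. c i \<le> C"
  proof -
    show "C0 \<le> C" using c(1) by (simp add: C_def sum_nonneg)
    fix i
    have "c i \<le> (\<Sum>i\<in>UNIV. c i)" by (rule member_le_sum) (use c(1) in auto)
    then show "c i \<le> C" using C0(1) by (simp add: C_def)
  qed
  show thesis
  proof
    fix z A :: "real^'n" assume z: "4 < norm z"
    define R where "R = norm z powr (m - 2)"
    have R: "1 \<le> R" using z m_ge by (simp add: R_def ge_one_powr_ge_zero)
    define a where "a = norm (ifourier (\<lambda>t. exp (phase K z t) * G t) A)"
    \<comment> \<open>Rescaling the frequency by 1/R turns the loss R^L from the L integrations by
      parts into a bound independent of z.\<close>
    have "(1 + norm ((1 / R) *\<^sub>R A)) ^ L * a \<le> (1 + real CARD('n)) ^ L * C"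
    proof (rule decay_from_components)
      show "a \<le> C" using C0(2)[OF z, of A] C(1) by (simp add: a_def)
      fix i
      have "\<bar>A $ i\<bar> ^ L * a \<le> c i * R ^ L" using c(2)[OF z] by (simp add: a_def R_def)
      also have "\<dots> \<le> C * R ^ L" using C(2) R by (intro mult_right_mono) auto
      finally have "\<bar>A $ i\<bar> ^ L * a / R ^ L \<le> C"
        using R by (simp add: pos_divide_le_eq)
      then show "\<bar>((1 / R) *\<^sub>R A) $ i\<bar> ^ L * a \<le> C"
        using R by (simp add: abs_mult power_divide)
    qed (simp add: a_def)
    then show "(1 + norm A / norm z powr (m - 2)) ^ L * norm (ifourier (\<lambda>t. exp (phase K z t) * G t) A)
        \<le> (1 + real CARD('n)) ^ L * C"
      using R by (simp add: a_def R_def)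
  qed
qed

end

section \<open>The Fourier transform of the localised kernel\<close>

text \<open>The majorant is not a plain tensor product: \<open>b x\<close> may vary with x as long
  as its integral stays bounded. For convolutions \<open>b x\<close> is a translate of one fixed
  function.\<close>

lemma integrable_pairI:
  fixes f :: "'a::euclidean_space \<Rightarrow> 'b::euclidean_space \<Rightarrow> complex"
  assumes meas: "case_prod f \<in> borel_measurable (lborel \<Otimes>\<^sub>M lborel)"
    and a: "integrable lborel a" and a0: "\<And>x. 0 \<le> a x"
    and b: "\<And>x. integrable lborel (b x)" "\<And>x. integral\<^sup>L lborel (b x) \<le> B"
    and le: "\<And>x v. norm (f x v) \<le> a x * b x v"
  shows "integrable (lborel \<Otimes>\<^sub>M lborel) (case_prod f)"
proof (rule lborel_pair.Fubini_integrable[OF meas])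
  have fx_meas: "f x \<in> borel_measurable lborel" for x
    using measurable_compose[OF measurable_Pair1' meas, of x] by simp
  have fx: "integrable lborel (f x)" for x
    by (rule Bochner_Integration.integrable_bound[OF integrable_mult_right[OF b(1)[of x], of "a x"] fx_meas])
      (intro AE_I2 order_trans[OF le], simp)
  then show "AE x in lborel. integrable lborel (\<lambda>v. case_prod f (x, v))" by simp
  show "integrable lborel (\<lambda>x. LINT v|lborel. norm (case_prod f (x, v)))"
  proof (rule Bochner_Integration.integrable_bound[OF integrable_mult_left[OF a, of B]])
    show "(\<lambda>x. LINT v|lborel. norm (case_prod f (x, v))) \<in> borel_measurable lborel"
      using meas by measurable
    show "AE x in lborel. norm (LINT v|lborel. norm (case_prod f (x, v))) \<le> norm (a x * B)"
    proof (rule AE_I2)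
      fix x
      have "(LINT v|lborel. norm (f x v)) \<le> (LINT v|lborel. a x * b x v)"
        by (intro integral_mono integrable_norm fx integrable_mult_right b le)
      also have "\<dots> \<le> a x * B"
        using b(2)[of x] a0[of x] by (simp add: mult_left_mono)
      also have "\<dots> \<le> norm (a x * B)" by simp
      finally show "norm (LINT v|lborel. norm (case_prod f (x, v))) \<le> norm (a x * B)"
        by (simp add: integral_nonneg_AE)
    qed
  qed
qed

lemma rapid_shift_integrable:
  fixes f :: "real^'n::finite \<Rightarrow> complex"
  assumes "rapid f"
  shows "integrable lborel (\<lambda>x. norm (f (x - c)))"
    and "(LINT x|lborel. norm (f (x - c))) = (LINT x|lborel. norm (f x))"
proof -
  have [measurable]: "f \<in> borel_measurable borel" by (rule rapid_measurable[OF assms])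
  obtain C where C: "\<And>x. norm (f x) \<le> C / (1 + norm x) ^ (2 * CARD('n))"
    using rapid_bound[OF assms] by blast
  have C0: "0 \<le> C" using order_trans[OF norm_ge_zero C[of 0]] by simp
  show "integrable lborel (\<lambda>x. norm (f (x - c)))"
  proof (rule integrable_weight_le[where C = "C * (1 + norm c) ^ (2 * CARD('n))"])
    fix x
    have "norm (f (x - c)) \<le> C * (1 / (1 + norm (x + - c)) ^ (2 * CARD('n)))"
      using C[of "x - c"] by simp
    also have "\<dots> \<le> C * ((1 + norm (- c)) ^ (2 * CARD('n)) / (1 + norm x) ^ (2 * CARD('n)))"
      by (intro mult_left_mono weight_shift_le C0)
    finally show "norm (norm (f (x - c))) \<le> C * (1 + norm c) ^ (2 * CARD('n)) / (1 + norm x) ^ (2 * CARD('n))"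
      by simp
  qed measurable
  show "(LINT x|lborel. norm (f (x - c))) = (LINT x|lborel. norm (f x))"
    using lborel_integral_shift[of "\<lambda>x. norm (f x)" "- c"] by simp
qed

lemma ifourier_translate:
  fixes g :: "real^'n::finite \<Rightarrow> complex"
  assumes [measurable]: "g \<in> borel_measurable borel"
  shows "ifourier (\<lambda>\<xi>. g (\<xi> - y)) u = exp (2 * pi * \<i> * complex_of_real (y \<bullet> u)) * ifourier g u"
proof -
  have "ifourier (\<lambda>\<xi>. g (\<xi> - y)) u
      = (LINT \<xi>|lborel. exp (2 * pi * \<i> * complex_of_real ((y + \<xi>) \<bullet> u)) * g (y + \<xi> - y))"
    unfolding ifourier_def
    by (rule lborel_integral_shift[symmetric]) measurable
  also have "\<dots> = (LINT \<xi>|lborel. exp (2 * pi * \<i> * complex_of_real (y \<bullet> u)) *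
      (exp (2 * pi * \<i> * complex_of_real (\<xi> \<bullet> u)) * g \<xi>))"
    by (simp add: inner_add_left distrib_left exp_add mult_ac)
  finally show ?thesis by (simp add: ifourier_def)
qed

text \<open>The product with a Fourier transform becomes a convolution by Fubini alone, without
  Fourier inversion.\<close>

lemma ifourier_mult_fourier:
  fixes f \<phi> :: "real^'n::finite \<Rightarrow> complex"
  assumes f: "integrable lborel f" and \<phi>: "integrable lborel \<phi>"
  shows "ifourier (\<lambda>\<xi>. f \<xi> * fourier \<phi> \<xi>) x = (LINT v|lborel. \<phi> v * ifourier f (x - v))"
proof -
  have [measurable]: "f \<in> borel_measurable borel" "\<phi> \<in> borel_measurable borel"
    using f \<phi> by (auto dest: borel_measurable_integrable)
  define k where "k \<xi> v = exp (2 * pi * \<i> * complex_of_real (\<xi> \<bullet> (x - v))) * f \<xi> * \<phi> v" for \<xi> v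
  have exps: "exp (2 * pi * \<i> * complex_of_real (\<xi> \<bullet> x)) * exp (- 2 * pi * \<i> * complex_of_real (\<xi> \<bullet> v))
      = exp (2 * pi * \<i> * complex_of_real (\<xi> \<bullet> (x - v)))" for \<xi> v
    by (simp add: exp_add[symmetric] inner_diff_right algebra_simps)
  have "ifourier (\<lambda>\<xi>. f \<xi> * fourier \<phi> \<xi>) x = (LINT \<xi>|lborel. LINT v|lborel. k \<xi> v)"
    unfolding ifourier_def fourier_def
  proof (rule Bochner_Integration.integral_cong[OF refl])
    fix \<xi> :: "real^'n"
    have "exp (2 * pi * \<i> * complex_of_real (\<xi> \<bullet> x)) *
        (f \<xi> * (LINT v|lborel. exp (- 2 * pi * \<i> * complex_of_real (\<xi> \<bullet> v)) * \<phi> v))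
      = (LINT v|lborel. (exp (2 * pi * \<i> * complex_of_real (\<xi> \<bullet> x)) * f \<xi>) *
          (exp (- 2 * pi * \<i> * complex_of_real (\<xi> \<bullet> v)) * \<phi> v))"
      by (simp add: mult.assoc)
    also have "\<dots> = (LINT v|lborel. k \<xi> v)"
      unfolding k_def exps[symmetric] by (simp add: mult_ac)
    finally show "exp (2 * pi * \<i> * complex_of_real (\<xi> \<bullet> x)) *
        (f \<xi> * (LINT v|lborel. exp (- 2 * pi * \<i> * complex_of_real (\<xi> \<bullet> v)) * \<phi> v)) = (LINT v|lborel. k \<xi> v)" .
  qed
  also have "\<dots> = (LINT v|lborel. LINT \<xi>|lborel. k \<xi> v)"
  proof (rule lborel_pair.Fubini_integral[symmetric], rule integrable_pairI)
    show "case_prod k \<in> borel_measurable (lborel \<Otimes>\<^sub>M lborel)"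
      unfolding k_def by measurable
    show "integrable lborel (\<lambda>\<xi>. norm (f \<xi>))" "integrable lborel (\<lambda>v. norm (\<phi> v))"
      using f \<phi> by (auto intro: integrable_norm)
    show "norm (k \<xi> v) \<le> norm (f \<xi>) * norm (\<phi> v)" for \<xi> v
      by (simp add: k_def norm_mult)
  qed auto
  also have "\<dots> = (LINT v|lborel. \<phi> v * ifourier f (x - v))"
    unfolding ifourier_def k_def by (simp add: mult.commute)
  finally show ?thesis .
qed

text \<open>Testing against \<phi> pairs F with the inverse transform of g(. - y) times
  \<open>fourier \<phi>\<close>. This is a convolution of \<phi> with a modulated
  \<open>ifourier g\<close>, and exchanging the integrals moves the x-integration onto F, which
  produces \<open>h\<close>.\<close>

lemma localized_multiplier_FL1_rep:
  fixes F g :: "real^'n::finite \<Rightarrow> complex" and y :: "real^'n"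
  defines "h \<equiv> \<lambda>v. LINT x|lborel. F x * (exp (2 * pi * \<i> * complex_of_real (y \<bullet> (x - v))) * ifourier g (x - v))"
  assumes [measurable]: "F \<in> borel_measurable borel" and F: "\<And>x. norm (F x) \<le> 1"
    and g: "g \<in> Schwartz" and h: "integrable lborel h"
  shows "h \<in> FL1_reps (dist_mult (\<lambda>x. g (x - y)) (dist_ifourier (reg_dist F)))"
  unfolding FL1_reps_def
proof (intro CollectI conjI ballI h)
  fix \<phi> :: "real^'n \<Rightarrow> complex" assume "\<phi> \<in> Schwartz"
  then have \<phi>: "rapid \<phi>" by (rule Schwartz_imp_rapid)
  have rg: "rapid g" by (rule Schwartz_imp_rapid[OF g])
  have G: "rapid (ifourier g)" by (rule rapid_ifourier[OF rg])
  have [measurable]: "\<phi> \<in> borel_measurable borel" "ifourier g \<in> borel_measurable borel" "g \<in> borel_measurable borel"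
    using \<phi> G rg by (auto intro: rapid_measurable)
  have gy: "integrable lborel (\<lambda>x. g (x - y))"
  proof (rule Bochner_Integration.integrable_bound[OF rapid_shift_integrable(1)[OF rg, of y]])
    show "(\<lambda>x. g (x - y)) \<in> borel_measurable lborel" by measurable
  qed simp
  define k where "k u = exp (2 * pi * \<i> * complex_of_real (y \<bullet> u)) * ifourier g u" for u
  have [measurable]: "k \<in> borel_measurable borel" unfolding k_def by measurable
  have nk: "norm (k u) = norm (ifourier g u)" for u by (simp add: k_def norm_mult)
  have "dist_fourier (dist_mult (\<lambda>x. g (x - y)) (dist_ifourier (reg_dist F))) \<phi>
      = (LINT x|lborel. F x * ifourier (\<lambda>\<xi>. g (\<xi> - y) * fourier \<phi> \<xi>) x)"
    by (simp add: dist_fourier_def dist_mult_def dist_ifourier_def reg_dist_def)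
  also have "\<dots> = (LINT x|lborel. F x * (LINT v|lborel. \<phi> v * k (x - v)))"
    by (simp add: ifourier_mult_fourier[OF gy rapid_integrable[OF \<phi>]] ifourier_translate k_def)
  also have "\<dots> = (LINT x|lborel. LINT v|lborel. F x * k (x - v) * \<phi> v)"
    by (simp add: integral_mult_right_zero[symmetric] mult_ac del: integral_mult_right_zero)
  also have "\<dots> = (LINT v|lborel. LINT x|lborel. F x * k (x - v) * \<phi> v)"
  proof (rule lborel_pair.Fubini_integral, rule integrable_pairI)
    show "(\<lambda>(v, x). F x * k (x - v) * \<phi> v) \<in> borel_measurable (lborel \<Otimes>\<^sub>M lborel)"
      by measurable
    show "integrable lborel (\<lambda>v. norm (\<phi> v))" by (intro integrable_norm rapid_integrable \<phi>)
    show "integrable lborel (\<lambda>x. norm (ifourier g (x - v)))" for v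
      by (rule rapid_shift_integrable(1)[OF G])
    show "(LINT x|lborel. norm (ifourier g (x - v))) \<le> (LINT x|lborel. norm (ifourier g x))" for v
      by (simp add: rapid_shift_integrable(2)[OF G])
    show "norm (F x * k (x - v) * \<phi> v) \<le> norm (\<phi> v) * norm (ifourier g (x - v))" for v x
    proof -
      have "norm (F x) * (norm (\<phi> v) * norm (ifourier g (x - v))) \<le> 1 * (norm (\<phi> v) * norm (ifourier g (x - v)))"
        using F by (intro mult_right_mono) auto
      then show ?thesis by (simp add: norm_mult nk mult_ac)
    qed
  qed simp
  also have "\<dots> = (LINT v|lborel. h v * \<phi> v)"
    by (simp add: h_def k_def)
  finally show "dist_fourier (dist_mult (\<lambda>x. g (x - y)) (dist_ifourier (reg_dist F))) \<phi> = (LINT v|lborel. h v * \<phi> v)" .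
qed

section \<open>The kernel of the localised multiplier and its L1 bound uniform in y\<close>

context homogeneous_phase
begin

definition kernel :: "(real^'n \<Rightarrow> complex) \<Rightarrow> real^'n \<Rightarrow> real^'n \<Rightarrow> complex" where
  "kernel G y z = (LINT x|lborel. exp (2 * pi * \<i> * complex_of_real (\<mu> x)) *
     (exp (2 * pi * \<i> * complex_of_real (y \<bullet> (x - z))) * G (x - z)))"

definition kernel_mut :: "nat \<Rightarrow> (real^'n \<Rightarrow> complex) \<Rightarrow> real^'n \<Rightarrow> real^'n \<Rightarrow> complex" where
  "kernel_mut K G y z = (LINT x|lborel. exp (2 * pi * \<i> * complex_of_real (mut K x)) *
     (exp (2 * pi * \<i> * complex_of_real (y \<bullet> (x - z))) * G (x - z)))"

text \<open>After the substitution x = z + t, the linear part taken out of the phase combines with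
  the modulation by y into the single frequency grad z + y.\<close>

lemma kernel_mut_eq:
  assumes [measurable]: "G \<in> borel_measurable borel"
  shows "kernel_mut K G y z = ifourier (\<lambda>t. exp (phase K z t) * G t) (grad z + y)"
proof -
  have [measurable]: "mut K \<in> borel_measurable borel" by (rule measurable_mut)
  have "kernel_mut K G y z = (LINT t|lborel. exp (2 * pi * \<i> * complex_of_real (mut K (z + t))) *
     (exp (2 * pi * \<i> * complex_of_real (y \<bullet> (z + t - z))) * G (z + t - z)))"
    unfolding kernel_mut_def by (rule lborel_integral_shift[symmetric]) measurable
  also have "\<dots> = ifourier (\<lambda>t. exp (phase K z t) * G t) (grad z + y)"
    unfolding ifourier_def
  proof (rule Bochner_Integration.integral_cong[OF refl])
    fix t
    have "exp (2 * pi * \<i> * complex_of_real (mut K (z + t))) * exp (2 * pi * \<i> * complex_of_real (y \<bullet> t))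
        = exp (2 * pi * \<i> * complex_of_real (t \<bullet> (grad z + y))) * exp (phase K z t)"
      unfolding phase_def exp_add[symmetric]
      by (simp add: inner_add_right inner_commute algebra_simps)
    then show "exp (2 * pi * \<i> * complex_of_real (mut K (z + t))) *
       (exp (2 * pi * \<i> * complex_of_real (y \<bullet> (z + t - z))) * G (z + t - z))
      = exp (2 * pi * \<i> * complex_of_real (t \<bullet> (grad z + y))) * (exp (phase K z t) * G t)"
      by (simp add: mult.assoc[symmetric])
  qed
  finally show ?thesis .
qed

lemma kernel_integrand_integrable:
  assumes G: "rapid G" and [measurable]: "f \<in> borel_measurable borel"
  shows "integrable lborel (\<lambda>x. exp (2 * pi * \<i> * complex_of_real (f x)) *
     (exp (2 * pi * \<i> * complex_of_real (y \<bullet> (x - z))) * G (x - z)))"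
proof (rule Bochner_Integration.integrable_bound[OF rapid_shift_integrable(1)[OF G, of z]])
  have [measurable]: "G \<in> borel_measurable borel" by (rule rapid_measurable[OF G])
  show "(\<lambda>x. exp (2 * pi * \<i> * complex_of_real (f x)) *
     (exp (2 * pi * \<i> * complex_of_real (y \<bullet> (x - z))) * G (x - z))) \<in> borel_measurable lborel"
    by measurable
qed (simp add: norm_mult)

text \<open>The two exponentials agree for |x| \<ge> 2, so the difference integrates G(x - z) over a
  fixed ball and inherits the decay of G in z. Only absolute values enter, hence the uniformity in
  y.\<close>

lemma kernel_diff_le:
  assumes G: "rapid G" and K: "0 < K"
  obtains C where "0 \<le> C" "\<And>y z. norm (kernel G y z - kernel_mut K G y z) \<le> C * (1 / (1 + norm z) ^ (2 * CARD('n)))"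
proof -
  define d where "d = 2 * CARD('n)"
  define W where "W = (LINT x|lborel. 1 / (1 + norm (x::real^'n)) ^ (2 * CARD('n)))"
  have W0: "0 \<le> W" unfolding W_def by (intro integral_nonneg_AE) auto
  have [measurable]: "G \<in> borel_measurable borel" "\<mu> \<in> borel_measurable borel" "mut K \<in> borel_measurable borel"
    using rapid_measurable[OF G] measurable_mu measurable_mut by auto
  obtain CG where CG: "\<And>x. norm (G x) \<le> CG / (1 + norm x) ^ d" using rapid_bound[OF G] by blast
  have CG0: "0 \<le> CG" using order_trans[OF norm_ge_zero CG[of 0]] by simp
  show thesis
  proof
    show "0 \<le> 2 * CG * 9 ^ d * W" using CG0 W0 by simp
    fix y z
    define k where "k x = exp (2 * pi * \<i> * complex_of_real (y \<bullet> (x - z))) * G (x - z)" for x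
    define a where "a x = exp (2 * pi * \<i> * complex_of_real (\<mu> x)) - exp (2 * pi * \<i> * complex_of_real (mut K x))" for x
    have "kernel G y z - kernel_mut K G y z = (LINT x|lborel. a x * k x)"
      unfolding kernel_def kernel_mut_def a_def k_def left_diff_distrib
      by (intro Bochner_Integration.integral_diff[symmetric] kernel_integrand_integrable G) measurable
    moreover have "norm (LINT x|lborel. a x * k x) \<le> (2 * CG * 9 ^ d / (1 + norm z) ^ d) * W"
      unfolding W_def
    proof (rule norm_integral_weight_le)
      show "(\<lambda>x. a x * k x) \<in> borel_measurable borel" unfolding a_def k_def by measurable
      fix x :: "real^'n"
      show "norm (a x * k x) \<le> 2 * CG * 9 ^ d / (1 + norm z) ^ d / (1 + norm x) ^ (2 * CARD('n))"
      proof (cases "2 \<le> norm x")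
        case True
        then have "a x = 0" using K by (simp add: a_def mut_eq)
        then show ?thesis using CG0 by simp
      next
        case False
        have "norm (a x) \<le> 2"
          unfolding a_def by (rule order_trans[OF norm_triangle_ineq4]) simp
        moreover have "norm (k x) \<le> CG * (1 / (1 + norm (x - z)) ^ d)"
          using CG[of "x - z"] by (simp add: k_def norm_mult)
        ultimately have "norm (a x * k x) \<le> 2 * (CG * (1 / (1 + norm (x - z)) ^ d))"
          unfolding norm_mult by (intro mult_mono) auto
        also have "1 / (1 + norm (x - z)) ^ d \<le> (1 + norm x) ^ d / (1 + norm z) ^ d"
          using weight_shift_le[of z "- x" d] by (simp add: norm_minus_commute)
        \<comment> \<open>As |x| < 2, (1 + |x|)^2 \<le> 9. One factor (1 + |x|)^d comes from
          recentring the weight; the other is put in to obtain an integrable weight in x.\<close>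
        also have "(1 + norm x) ^ d / (1 + norm z) ^ d \<le> (9 ^ d / (1 + norm z) ^ d) / (1 + norm x) ^ d"
        proof -
          have "(1 + norm x) * (1 + norm x) \<le> 3 * 3" using False by (intro mult_mono) auto
          then have "((1 + norm x) * (1 + norm x)) ^ d \<le> 9 ^ d" by (intro power_mono) auto
          then have "(1 + norm x) ^ d \<le> 9 ^ d / (1 + norm x) ^ d"
            by (simp add: power_mult_distrib pos_le_divide_eq add_pos_nonneg)
          then have "(1 + norm x) ^ d / (1 + norm z) ^ d \<le> (9 ^ d / (1 + norm x) ^ d) / (1 + norm z) ^ d"
            by (intro divide_right_mono) auto
          then show ?thesis by (simp add: mult.commute)
        qed
        finally show ?thesis using CG0 by (simp add: d_def mult_left_mono mult.assoc)
      qed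
    qed
    ultimately show "norm (kernel G y z - kernel_mut K G y z) \<le> 2 * CG * 9 ^ d * W * (1 / (1 + norm z) ^ (2 * CARD('n)))"
      by (simp add: d_def)
  qed
qed

lemma kernel_norm_le:
  assumes G: "rapid G"
  shows "norm (kernel G y z) \<le> (LINT x|lborel. norm (G x))"
proof -
  have "norm (kernel G y z) \<le> (LINT x|lborel. norm (exp (2 * pi * \<i> * complex_of_real (\<mu> x)) *
     (exp (2 * pi * \<i> * complex_of_real (y \<bullet> (x - z))) * G (x - z))))"
    unfolding kernel_def by (rule integral_norm_bound)
  also have "\<dots> = (LINT x|lborel. norm (G (x - z)))"
    by (simp add: norm_mult)
  finally show ?thesis using rapid_shift_integrable(2)[OF G, of z] by simp
qed

text \<open>The order of quantifiers is the point: \<open>D\<close> and \<open>C\<close> are fixed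
  before y, and only the centres \<open>p e\<close> move with y. The weight centred at 0 covers both
  small z and the error from the cutoff.\<close>

lemma kernel_bound:
  assumes G: "rapid G"
  obtains D :: "(real^'n) set" and C :: real where "finite D" "0 \<le> C"
    "\<And>y. \<exists>p. \<forall>z. norm (kernel G y z) \<le> C * (1 / (1 + norm z) ^ (2 * CARD('n)) + (\<Sum>e\<in>D. 1 / (1 + norm (z - p e)) ^ (2 * CARD('n))))"
proof -
  define d where "d = 2 * CARD('n)"
  \<comment> \<open>The bound needs d derivatives of the phase gradient, hence d + 2 < K.\<close>
  define K where "K = Suc (Suc (Suc d))"
  obtain D :: "(real^'n) set" and c :: real where D: "finite D" "0 < c"
    "\<And>y. \<exists>p. \<forall>z. norm z \<ge> 1 \<longrightarrow> (\<exists>e\<in>D. 1 + c * norm (z - p e) \<le> 2 * (1 + norm (grad z + y) / norm z powr (m - 2)))"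
    using grad_shift_weight by blast
  obtain C1 where C1: "0 \<le> C1" "\<And>y z. norm (kernel G y z - kernel_mut K G y z) \<le> C1 * (1 / (1 + norm z) ^ d)"
    using kernel_diff_le[OF G, of K] unfolding d_def K_def by blast
  obtain C2 where C2: "\<And>z A. 4 < norm z \<Longrightarrow>
    (1 + norm A / norm z powr (m - 2)) ^ d * norm (ifourier (\<lambda>t. exp (phase K z t) * G t) A) \<le> C2"
    using phase_fourier_decay[of d K G] G unfolding K_def by blast
  define C0 where "C0 = (LINT x|lborel. norm (G x))"
  have C00: "0 \<le> C0" unfolding C0_def by (intro integral_nonneg_AE) auto
  \<comment> \<open>This constant converts 1 + c r into 1 + r.\<close>
  define b where "b = max 1 (1 / c)"
  have b: "1 + r \<le> b * (1 + c * r)" if "0 \<le> r" for r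
  proof -
    have "r = (1 / c) * (c * r)" using D(2) by simp
    also have "\<dots> \<le> b * (c * r)" using D(2) that by (intro mult_right_mono) (auto simp: b_def)
    finally have "r \<le> b * (c * r)" .
    moreover have "1 \<le> b" by (simp add: b_def)
    ultimately show ?thesis unfolding distrib_left by linarith
  qed
  \<comment> \<open>The three summands belong to |z| \<le> 4, where the trivial bound is used and 1
    + |z| \<le> 5, to the error from the cutoff, and to the oscillatory estimate.\<close>
  define C where "C = C0 * 5 ^ d + C1 + \<bar>C2\<bar> * (2 * b) ^ d"
  have b0: "0 \<le> \<bar>C2\<bar> * (2 * b) ^ d" by (simp add: b_def)
  have C: "C0 * 5 ^ d \<le> C" "C1 \<le> C" "\<bar>C2\<bar> * (2 * b) ^ d \<le> C" "0 \<le> C"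
    using C1(1) C00 b0 by (simp_all add: C_def)
  have "\<exists>p. \<forall>z. norm (kernel G y z) \<le> C * (1 / (1 + norm z) ^ d + (\<Sum>e\<in>D. 1 / (1 + norm (z - p e)) ^ d))" for y
  proof -
    obtain p where p: "\<And>z. norm z \<ge> 1 \<Longrightarrow> \<exists>e\<in>D. 1 + c * norm (z - p e) \<le> 2 * (1 + norm (grad z + y) / norm z powr (m - 2))"
      using D(3) by blast
    have "norm (kernel G y z) \<le> C * (1 / (1 + norm z) ^ d + (\<Sum>e\<in>D. 1 / (1 + norm (z - p e)) ^ d))" for z
    proof (cases "4 < norm z")
      case False
      have "(1 + norm z) ^ d \<le> 5 ^ d" using False by (intro power_mono) auto
      then have "1 \<le> 5 ^ d * (1 / (1 + norm z) ^ d)"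
        by (simp add: pos_le_divide_eq add_pos_nonneg)
      then have "C0 * 1 \<le> C0 * (5 ^ d * (1 / (1 + norm z) ^ d))" using C00 by (intro mult_left_mono)
      also have "\<dots> = (C0 * 5 ^ d) * (1 / (1 + norm z) ^ d)" by simp
      also have "\<dots> \<le> C * (1 / (1 + norm z) ^ d + (\<Sum>e\<in>D. 1 / (1 + norm (z - p e)) ^ d))"
        using C C00 by (intro mult_mono) (auto intro!: sum_nonneg)
      finally show ?thesis using kernel_norm_le[OF G, of y z] by (simp add: C0_def)
    next
      case True
      then obtain e where e: "e \<in> D" "1 + c * norm (z - p e) \<le> 2 * (1 + norm (grad z + y) / norm z powr (m - 2))"
        using p[of z] by auto
      define w where "w = 1 + norm (grad z + y) / norm z powr (m - 2)"
      have "1 + norm (z - p e) \<le> b * (1 + c * norm (z - p e))" by (rule b) simp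
      also have "\<dots> \<le> b * (2 * w)" using e(2) by (intro mult_left_mono) (auto simp: w_def b_def)
      finally have wle: "1 + norm (z - p e) \<le> (2 * b) * w" by simp
      have "norm (kernel_mut K G y z) * (1 + norm (z - p e)) ^ d \<le> norm (kernel_mut K G y z) * ((2 * b) * w) ^ d"
        using wle by (intro mult_left_mono power_mono) auto
      also have "\<dots> = (2 * b) ^ d * (w ^ d * norm (kernel_mut K G y z))"
        by (simp add: power_mult_distrib)
      also have "\<dots> \<le> (2 * b) ^ d * \<bar>C2\<bar>"
        unfolding w_def kernel_mut_eq[OF rapid_measurable[OF G]]
        by (intro mult_left_mono order_trans[OF C2[OF True] abs_ge_self]) (auto simp: b_def)
      finally have "norm (kernel_mut K G y z) \<le> (\<bar>C2\<bar> * (2 * b) ^ d) * (1 / (1 + norm (z - p e)) ^ d)"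
        by (simp add: pos_le_divide_eq add_pos_nonneg mult.commute)
      also have "\<dots> \<le> C * (1 / (1 + norm (z - p e)) ^ d)"
        using C by (intro mult_right_mono) auto
      also have "\<dots> \<le> C * (\<Sum>e\<in>D. 1 / (1 + norm (z - p e)) ^ d)"
        using C by (intro mult_left_mono member_le_sum[OF e(1)] D(1)) auto
      finally have 1: "norm (kernel_mut K G y z) \<le> C * (\<Sum>e\<in>D. 1 / (1 + norm (z - p e)) ^ d)" .
      have "C1 * (1 / (1 + norm z) ^ d) \<le> C * (1 / (1 + norm z) ^ d)"
        using C by (intro mult_right_mono) auto
      then have "norm (kernel G y z - kernel_mut K G y z) \<le> C * (1 / (1 + norm z) ^ d)"
        using C1(2)[of y z] by linarith
      moreover have "norm (kernel G y z) \<le> norm (kernel_mut K G y z) + norm (kernel G y z - kernel_mut K G y z)"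
        by (rule norm_triangle_sub)
      ultimately show ?thesis using 1 unfolding distrib_left by linarith
    qed
    then show ?thesis by blast
  qed
  then show thesis using that[of D C] D(1) C(4) unfolding d_def by blast
qed

lemma measurable_kernel:
  assumes [measurable]: "G \<in> borel_measurable borel"
  shows "kernel G y \<in> borel_measurable borel"
proof -
  have [measurable]: "\<mu> \<in> borel_measurable borel" by (rule measurable_mu)
  show ?thesis unfolding kernel_def[abs_def] by measurable
qed

text \<open>All translates of the weight have the same integral W, so the moving centres leave no
  trace in the bound.\<close>

lemma kernel_L1_bound:
  assumes G: "rapid G"
  obtains B :: real where "\<And>y. integrable lborel (kernel G y)" "\<And>y. (\<integral>\<^sup>+ z. ennreal (norm (kernel G y z)) \<partial>lborel) \<le> ennreal B"
proof -
  define d where "d = 2 * CARD('n)"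
  define W where "W = (LINT x|lborel. 1 / (1 + norm (x::real^'n)) ^ d)"
  obtain D :: "(real^'n) set" and C :: real where D: "finite D" "0 \<le> C"
    "\<And>y. \<exists>p. \<forall>z. norm (kernel G y z) \<le> C * (1 / (1 + norm z) ^ d + (\<Sum>e\<in>D. 1 / (1 + norm (z - p e)) ^ d))"
    using kernel_bound[OF G] unfolding d_def by blast
  have wint: "integrable lborel (\<lambda>z::real^'n. 1 / (1 + norm (z - q)) ^ d)" for q :: "real^'n"
  proof (rule integrable_weight_le[where C = "(1 + norm q) ^ d"])
    show "norm (1 / (1 + norm (z - q)) ^ d) \<le> (1 + norm q) ^ d / (1 + norm z) ^ (2 * CARD('n))" for z
      using weight_shift_le[of z "- q" d] by (simp add: d_def)
  qed measurable
  have wval: "(LINT z|lborel. 1 / (1 + norm (z - q)) ^ d) = W" for q :: "real^'n"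
    using lborel_integral_shift[of "\<lambda>z::real^'n. 1 / (1 + norm z) ^ d" "- q"] by (simp add: W_def)
  have w0: "integrable lborel (\<lambda>z::real^'n. 1 / (1 + norm z) ^ d)"
    using wint[of 0] by simp
  have both: "integrable lborel (kernel G y) \<and>
    (\<integral>\<^sup>+ z. ennreal (norm (kernel G y z)) \<partial>lborel) \<le> ennreal (C * (W + real (card D) * W))" for y
  proof -
    obtain p where p: "\<And>z. norm (kernel G y z) \<le> C * (1 / (1 + norm z) ^ d + (\<Sum>e\<in>D. 1 / (1 + norm (z - p e)) ^ d))"
      using D(3) by blast
    define bd where "bd z = C * (1 / (1 + norm z) ^ d + (\<Sum>e\<in>D. 1 / (1 + norm (z - p e)) ^ d))" for z
    have bd_int: "integrable lborel bd"
      unfolding bd_def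
      by (intro integrable_mult_right Bochner_Integration.integrable_add Bochner_Integration.integrable_sum w0 wint)
    have bd_val: "integral\<^sup>L lborel bd = C * (W + real (card D) * W)"
    proof -
      have "integral\<^sup>L lborel bd = C * ((LINT z|lborel. 1 / (1 + norm (z::real^'n)) ^ d) + (\<Sum>e\<in>D. LINT z|lborel. 1 / (1 + norm (z - p e)) ^ d))"
        unfolding bd_def integral_mult_right_zero
        by (subst Bochner_Integration.integral_add[OF w0 Bochner_Integration.integrable_sum[OF wint]],
            subst Bochner_Integration.integral_sum[OF wint]) (rule refl)
      then show ?thesis unfolding wval by (simp add: W_def)
    qed
    have bd0: "0 \<le> bd z" for z using order_trans[OF norm_ge_zero p[of z]] by (simp add: bd_def)
    have "integrable lborel (kernel G y)"
    proof (rule Bochner_Integration.integrable_bound[OF bd_int])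
      show "kernel G y \<in> borel_measurable lborel"
        using measurable_kernel[OF rapid_measurable[OF G]] by simp
      show "AE z in lborel. norm (kernel G y z) \<le> norm (bd z)"
        using p bd0 by (intro AE_I2) (simp add: bd_def)
    qed
    moreover have "(\<integral>\<^sup>+ z. ennreal (norm (kernel G y z)) \<partial>lborel) \<le> (\<integral>\<^sup>+ z. ennreal (bd z) \<partial>lborel)"
      using p by (intro nn_integral_mono ennreal_leI) (simp add: bd_def)
    moreover have "(\<integral>\<^sup>+ z. ennreal (bd z) \<partial>lborel) = ennreal (C * (W + real (card D) * W))"
      using nn_integral_eq_integral[OF bd_int] bd0 bd_val by simp
    ultimately show ?thesis by simp
  qed
  show thesis by (rule that[of "C * (W + real (card D) * W)"]) (use both in auto)
qed

end

theorem theorem1p1: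
  fixes \<mu> :: "real^'n::finite \<Rightarrow> real" and m :: real and g :: "real^'n \<Rightarrow> complex"
  assumes smooth: "smooth_on (- {0}) \<mu>"
    and m_ge: "m \<ge> 2"
    and homog: "\<And>t x. t > 0 \<Longrightarrow> x \<noteq> 0 \<Longrightarrow> \<mu> (t *\<^sub>R x) = t powr m * \<mu> x"
    and hess: "\<And>x. norm x = 1 \<Longrightarrow> det (\<chi> i j. iter_partial [i, j] \<mu> x) \<noteq> 0"
    and g: "g \<in> Schwartz"
  shows "(SUP y. FL1_norm (dist_mult (\<lambda>x. g (x - y))
            (dist_ifourier (reg_dist (\<lambda>x. exp (2 * pi * \<i> * complex_of_real (\<mu> x))))))) < \<infinity>"
proof -
  interpret homogeneous_phase \<mu> m
    by unfold_locales (use smooth m_ge homog hess in auto)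
  have [measurable]: "\<mu> \<in> borel_measurable borel" by (rule measurable_mu)
  define G where "G = ifourier g"
  have "rapid G" unfolding G_def by (intro rapid_ifourier Schwartz_imp_rapid g)
  then obtain B :: real where B: "\<And>y. integrable lborel (kernel G y)"
    "\<And>y. (\<integral>\<^sup>+ z. ennreal (norm (kernel G y z)) \<partial>lborel) \<le> ennreal B"
    using kernel_L1_bound by blast
  have "FL1_norm (dist_mult (\<lambda>x. g (x - y))
      (dist_ifourier (reg_dist (\<lambda>x. exp (2 * pi * \<i> * complex_of_real (\<mu> x)))))) \<le> ennreal B" for y
  proof -
    have "kernel G y \<in> FL1_reps (dist_mult (\<lambda>x. g (x - y))
        (dist_ifourier (reg_dist (\<lambda>x. exp (2 * pi * \<i> * complex_of_real (\<mu> x))))))"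
      using B(1)[of y] unfolding kernel_def[abs_def] G_def
      by (intro localized_multiplier_FL1_rep g) (auto simp del: of_real_mult)
    \<comment> \<open>The norm is an infimum over representing functions, so a single representative
      bounds it.\<close>
    then show ?thesis
      unfolding FL1_norm_def by (rule INF_lower2) (rule B(2))
  qed
  then have "(SUP y. FL1_norm (dist_mult (\<lambda>x. g (x - y))
      (dist_ifourier (reg_dist (\<lambda>x. exp (2 * pi * \<i> * complex_of_real (\<mu> x))))))) \<le> ennreal B"
    by (rule SUP_least)
  also have "\<dots> < \<infinity>" by simp
  finally show ?thesis .
qed

end
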